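(* Let $\delta:\mathcal G\to W$ be a strict $W$-groupoid of type $M$, and let $\mathcal W(\mathcal G)$ be the Weyl data associated to $\delta:\mathcal G\to W$. Then $\mathcal W(\mathcal G)$ is a Weyl graph.
   Context: Setting. $M=(m_{st})_{s,t\in S}$ is a Coxeter matrix on a finite set $S$, and $W=\langle S\mid (st)^{m_{st}}=1,\ m_{st}<\infty\rangle$ is its Coxeter group. A word over $S$ is reduced if no shorter word represents the same element of $W$. For $s\ne t$ let $p_m(s,t)=stst\cdots$ ($m$ letters), and if $m_{st}<\infty$ let $p(s,t)=p_{m_{st}}(s,t)$. Bruhat order on $W$: $u\le w$ if some reduced word for $w$ has a (not necessarily consecutive) subsequence which is a word for $u$. Groupoids are small and non-empty, with composition $g;h$ (or $gh$) written left to right, defined when $\tau(g)=\iota(h)$, where $\iota,\tau$ denote initial and terminal vertices. Weyl data. A generalized chamber system $\mathcal W$ of type $M$ is a set $\mathcal W_0$ of chambers with a family of groupoids $(\mathcal W_s)_{s\in S}$ (panel groupoids), each with vertex set $\mathcal W_0$. An edge of $\mathcal W$ of type $s$ is a non-identity edge of $\mathcal W_s$ (edges of different types are distinct). An $s$-panel is a connected component of $\mathcal W_s$. A gallery $\beta$ is a finite sequence of consecutive edges (a trivial gallery is a single chamber with no edges), with initial chamber $\iota(\beta)$, terminal chamber $\tau(\beta)$, type $\beta_S$ (the word of types of its edges), and $W$-length $\beta_W\in W$ (the element represented by $\beta_S$). It is a cycle if $\iota(\beta)=\tau(\beta)$, and a geodesic if $\beta_S$ is reduced. For $s\neq t$ with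 $m_{st}<\infty$: a maximal $(s,t)$-geodesic is a gallery of type $p(s,t)$; an $(s,t)$-cycle is a cycle of type $p_{2m_{st}}(s,t)$. Weyl data of type $M$ is a generalized chamber system of type $M$ together with, for each ordered pair $(s,t)$ with $s\neq t$, $m_{st}<\infty$, a set of $(s,t)$-cycles called defining suites. Homotopy. Elementary homotopies of galleries are the following moves on subgalleries and their inverses: delete $i\,i^{-1}$; replace $i\,i'$ ($i,i'$ of the same type, $i'\ne i^{-1}$) by the single edge $i;i'$; delete a defining suite. Galleries are homotopic ($\sim$) if related by finitely many such moves. A pre-Weyl graph is Weyl data satisfying (PW0) no panel is a trivial groupoid (one vertex, one edge), and (PW1) each maximal $(s,t)$-geodesic is homotopic to a maximal $(t,s)$-geodesic. A Weyl graph is a pre-Weyl graph satisfying (W) homotopic geodesics have the same $W$-length. $W$-groupoids. A $W$-groupoid (of type $M$) on a groupoid $\mathcal G$ is a function $\delta$ from the edges of $\mathcal G$ to $W$ such that: (weak) for every vertex $C$ and every $s\in S$ there is an edge $g$ with $\iota(g)=C$ and $\delta(g)=s$; (WG1) $\delta(1)=1$ for all identity edges; (WG2) $\delta(gh)\ge\delta(g)\delta(h)$ in the Bruhat order whenever $gh$ is defined; (WG3) for every edge $g$ and $s\in S$ with $\delta(g)s<\delta(g)$ there is an edge $h$ with $\iota(h)=\iota(g)$, $\delta(h^{-1}g)=s$ and $\delta(h)=\delta(g)s$. It is strict if in addition $\delta(g)=1$ implies that $g$ is an identity edge. Associated Weyl data. For a strict $W$-groupoid $\delta:\mathcal G\to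 W$ and $s\in S$, the parabolic groupoid $\mathcal G_s$ is the subgroupoid of $\mathcal G$ with all vertices and with edges $\{g:\delta(g)\in\{1,s\}\}$. $\mathcal W(\mathcal G)$ is the Weyl data of type $M$ with chambers the vertices of $\mathcal G$, panel groupoids $(\mathcal G_s)_{s\in S}$, and defining suites all $(s,t)$-cycles ($s\ne t$, $m_{st}<\infty$) whose sequence of edges composes in $\mathcal G$ to an identity edge. *)

theory Defs
  imports "HOL-Library.Extended_Nat" "HOL-Library.Sublist" "HOL-Algebra.Group"
begin

section \<open>Coxeter groups\<close>

locale coxeter_matrix =
  fixes S :: "'s set" and m :: "'s \<Rightarrow> 's \<Rightarrow> enat"
  assumes finite_S: "finite S"
    and diag: "s \<in> S \<Longrightarrow> m s s = 1"
    and symmetric: "s \<in> S \<Longrightarrow> t \<in> S \<Longrightarrow> m s t = m t s"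
    and off_diag: "s \<in> S \<Longrightarrow> t \<in> S \<Longrightarrow> s \<noteq> t \<Longrightarrow> 2 \<le> m s t"

inductive word_step :: "'s set \<Rightarrow> ('s \<Rightarrow> 's \<Rightarrow> enat) \<Rightarrow> 's list \<Rightarrow> 's list \<Rightarrow> bool"
  for S :: "'s set" and m :: "'s \<Rightarrow> 's \<Rightarrow> enat"
  where
    relator: "\<lbrakk>s \<in> S; t \<in> S; m s t = enat k; xs \<in> lists S; ys \<in> lists S\<rbrakk> \<Longrightarrow>
      word_step S m (xs @ concat (replicate k [s, t]) @ ys) (xs @ ys)"

definition word_class :: "'s set \<Rightarrow> ('s \<Rightarrow> 's \<Rightarrow> enat) \<Rightarrow> 's list \<Rightarrow> 's list set" where
  "word_class S m xs = {ys \<in> lists S. equivclp (word_step S m) xs ys}"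

text \<open>The group presented by \<open>S\<close> and the relations \<open>(st)^m_st = 1\<close>.  As \<open>m_ss = 1\<close> makes every
  generator an involution, classes of positive words suffice; that this is the presented group is
  confirmed below by its universal property (\<open>coxeter_group_universal\<close>).\<close>

definition coxeter_group :: "'s set \<Rightarrow> ('s \<Rightarrow> 's \<Rightarrow> enat) \<Rightarrow> 's list set monoid" where
  "coxeter_group S m =
    \<lparr>carrier = word_class S m ` lists S,
     monoid.mult = (\<lambda>X Y. \<Union>x\<in>X. \<Union>y\<in>Y. word_class S m (x @ y)),
     one = word_class S m []\<rparr>"

definition generator :: "'s set \<Rightarrow> ('s \<Rightarrow> 's \<Rightarrow> enat) \<Rightarrow> 's \<Rightarrow> 's list set" where
  "generator S m s = word_class S m [s]"

definition reduced_word :: "'s set \<Rightarrow> ('s \<Rightarrow> 's \<Rightarrow> enat) \<Rightarrow> 's list \<Rightarrow> bool" where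
  "reduced_word S m xs \<longleftrightarrow> xs \<in> lists S \<and>
    (\<forall>ys\<in>lists S. word_class S m ys = word_class S m xs \<longrightarrow> length xs \<le> length ys)"

definition bruhat_le ::
    "'s set \<Rightarrow> ('s \<Rightarrow> 's \<Rightarrow> enat) \<Rightarrow> 's list set \<Rightarrow> 's list set \<Rightarrow> bool" where
  "bruhat_le S m u w \<longleftrightarrow>
    (\<exists>xs ys. reduced_word S m xs \<and> word_class S m xs = w \<and> subseq ys xs \<and> word_class S m ys = u)"

definition bruhat_less ::
    "'s set \<Rightarrow> ('s \<Rightarrow> 's \<Rightarrow> enat) \<Rightarrow> 's list set \<Rightarrow> 's list set \<Rightarrow> bool" where
  "bruhat_less S m u w \<longleftrightarrow> bruhat_le S m u w \<and> u \<noteq> w"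

text \<open>\<open>alt_word n s t\<close> is the word \<open>stst\<dots>\<close> with \<open>n\<close> letters.\<close>

fun alt_word :: "nat \<Rightarrow> 's \<Rightarrow> 's \<Rightarrow> 's list" where
  "alt_word 0 s t = []"
| "alt_word (Suc n) s t = s # alt_word n t s"

lemma equivclp_word_step_append:
  assumes "equivclp (word_step S m) x y" "u \<in> lists S" "v \<in> lists S"
  shows "equivclp (word_step S m) (u @ x @ v) (u @ y @ v)"
  using assms(1)
proof (induction rule: equivclp_induct)
  case base
  show ?case by simp
next
  case (step y z)
  have *: "word_step S m (u @ a @ v) (u @ b @ v)" if "word_step S m a b" for a b
    using that
  proof cases
    case (relator s t k xs ys)
    have "word_step S m ((u @ xs) @ concat (replicate k [s, t]) @ (ys @ v)) ((u @ xs) @ (ys @ v))"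
      by (rule word_step.relator) (use relator assms in auto)
    then show ?thesis using relator by simp
  qed
  show ?case
    using step * by (meson equivclp_into_equivclp)
qed

lemma word_class_eq_iff:
  assumes "x \<in> lists S" "y \<in> lists S"
  shows "word_class S m x = word_class S m y \<longleftrightarrow> equivclp (word_step S m) x y"
proof
  assume "word_class S m x = word_class S m y"
  moreover have "y \<in> word_class S m y" using assms by (simp add: word_class_def)
  ultimately show "equivclp (word_step S m) x y" by (auto simp: word_class_def)
next
  assume "equivclp (word_step S m) x y"
  then show "word_class S m x = word_class S m y"
    unfolding word_class_def by (blast intro: equivclp_trans equivclp_sym)
qed

lemma word_class_mult:
  assumes "x \<in> lists S" "y \<in> lists S"
  shows "word_class S m x \<otimes>\<^bsub>coxeter_group S m\<^esub> word_class S m y = word_class S m (x @ y)"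
proof -
  have "word_class S m (x' @ y') = word_class S m (x @ y)"
    if "x' \<in> word_class S m x" "y' \<in> word_class S m y" for x' y'
  proof -
    from that have l: "x' \<in> lists S" "y' \<in> lists S"
      and e: "equivclp (word_step S m) x x'" "equivclp (word_step S m) y y'"
      by (auto simp: word_class_def)
    have "equivclp (word_step S m) (x @ y) (x' @ y)"
      using equivclp_word_step_append[OF e(1), of "[]" y] assms by simp
    moreover have "equivclp (word_step S m) (x' @ y) (x' @ y')"
      using equivclp_word_step_append[OF e(2), of x' "[]"] l by simp
    ultimately have "equivclp (word_step S m) (x @ y) (x' @ y')"
      by (rule equivclp_trans)
    then show ?thesis using word_class_eq_iff[of "x @ y" S "x' @ y'" m] l assms by simp
  qed
  moreover have "x \<in> word_class S m x" "y \<in> word_class S m y"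
    using assms by (auto simp: word_class_def)
  ultimately have "(\<Union>x'\<in>word_class S m x. \<Union>y'\<in>word_class S m y. word_class S m (x' @ y')) =
      word_class S m (x @ y)"
    by blast
  then show ?thesis by (simp add: coxeter_group_def)
qed

context coxeter_matrix
begin

lemma group_coxeter_group: "group (coxeter_group S m)"
proof (rule groupI)
  have c: "carrier (coxeter_group S m) = word_class S m ` lists S"
    and o: "\<one>\<^bsub>coxeter_group S m\<^esub> = word_class S m []"
    by (simp_all add: coxeter_group_def)
  show "x \<otimes>\<^bsub>coxeter_group S m\<^esub> y \<in> carrier (coxeter_group S m)"
    if xy: "x \<in> carrier (coxeter_group S m)" "y \<in> carrier (coxeter_group S m)" for x y
  proof -
    obtain a b where ab: "a \<in> lists S" "b \<in> lists S" "x = word_class S m a" "y = word_class S m b"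
      using xy unfolding c by blast
    then have "a @ b \<in> lists S" by simp
    then show ?thesis unfolding c using ab word_class_mult[of a S b m] by blast
  qed
  show "\<one>\<^bsub>coxeter_group S m\<^esub> \<in> carrier (coxeter_group S m)"
    unfolding c o by auto
  show "(x \<otimes>\<^bsub>coxeter_group S m\<^esub> y) \<otimes>\<^bsub>coxeter_group S m\<^esub> z =
      x \<otimes>\<^bsub>coxeter_group S m\<^esub> (y \<otimes>\<^bsub>coxeter_group S m\<^esub> z)"
    if xyz: "x \<in> carrier (coxeter_group S m)" "y \<in> carrier (coxeter_group S m)"
      "z \<in> carrier (coxeter_group S m)" for x y z
  proof -
    obtain a b d where l: "a \<in> lists S" "b \<in> lists S" "d \<in> lists S"
      and e: "x = word_class S m a" "y = word_class S m b" "z = word_class S m d"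
      using xyz unfolding c by blast
    from l have "a @ b \<in> lists S" "b @ d \<in> lists S" by simp_all
    with l show ?thesis unfolding e
      by (simp only: word_class_mult append_assoc)
  qed
  show "\<one>\<^bsub>coxeter_group S m\<^esub> \<otimes>\<^bsub>coxeter_group S m\<^esub> x = x"
    if x: "x \<in> carrier (coxeter_group S m)" for x
  proof -
    obtain a where "a \<in> lists S" "x = word_class S m a"
      using x unfolding c by blast
    then show ?thesis unfolding o using word_class_mult[of "[]" S a m] by simp
  qed
  have rv: "word_class S m (rev x @ x) = word_class S m []" if "x \<in> lists S" for x
    using that
  proof (induction x)
    case Nil
    show ?case by simp
  next
    case (Cons a x)
    then have a: "a \<in> S" "x \<in> lists S" by auto
    have "word_step S m (rev x @ concat (replicate 1 [a, a]) @ x) (rev x @ x)"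
      by (rule word_step.relator) (use a diag in \<open>auto simp: one_enat_def\<close>)
    then have "equivclp (word_step S m) (rev (a # x) @ (a # x)) (rev x @ x)"
      by (auto intro: r_into_equivclp)
    then have "word_class S m (rev (a # x) @ (a # x)) = word_class S m (rev x @ x)"
      using a by (subst word_class_eq_iff) auto
    then show ?case using Cons a by simp
  qed
  show "\<exists>y\<in>carrier (coxeter_group S m). y \<otimes>\<^bsub>coxeter_group S m\<^esub> x = \<one>\<^bsub>coxeter_group S m\<^esub>"
    if x: "x \<in> carrier (coxeter_group S m)" for x
  proof -
    from x obtain xs where xs: "xs \<in> lists S" "x = word_class S m xs" unfolding c by auto
    have r: "rev xs \<in> lists S" using xs by auto
    have "word_class S m (rev xs) \<otimes>\<^bsub>coxeter_group S m\<^esub> x = \<one>\<^bsub>coxeter_group S m\<^esub>"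
      unfolding o xs(2) using rv[OF xs(1)] by (simp only: word_class_mult[OF r xs(1)])
    then show ?thesis unfolding c using r by blast
  qed
qed

lemma coxeter_group_relation:
  assumes "s \<in> S" "t \<in> S" "m s t = enat k"
  shows "(generator S m s \<otimes>\<^bsub>coxeter_group S m\<^esub> generator S m t) [^]\<^bsub>coxeter_group S m\<^esub> k
    = \<one>\<^bsub>coxeter_group S m\<^esub>"
proof -
  interpret W: group "coxeter_group S m" by (rule group_coxeter_group)
  have lr: "concat (replicate n [s, t]) \<in> lists S" for n
    using assms by (induction n) auto
  have st: "generator S m s \<otimes>\<^bsub>coxeter_group S m\<^esub> generator S m t = word_class S m [s, t]"
    using assms by (simp add: generator_def word_class_mult)
  have stc: "word_class S m [s, t] \<in> carrier (coxeter_group S m)"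
    using assms by (auto simp: coxeter_group_def)
  have pw: "word_class S m [s, t] [^]\<^bsub>coxeter_group S m\<^esub> n
      = word_class S m (concat (replicate n [s, t]))" for n :: nat
  proof (induction n)
    case 0
    show ?case by (simp add: coxeter_group_def)
  next
    case (Suc n)
    have "word_class S m [s, t] [^]\<^bsub>coxeter_group S m\<^esub> Suc n =
        word_class S m [s, t] \<otimes>\<^bsub>coxeter_group S m\<^esub> word_class S m (concat (replicate n [s, t]))"
      unfolding Suc[symmetric] using stc by (rule W.nat_pow_Suc2)
    also have "\<dots> = word_class S m (concat (replicate (Suc n) [s, t]))"
      using assms lr[of n] word_class_mult[of "[s, t]" S "concat (replicate n [s, t])" m] by simp
    finally show ?case .
  qed
  have "word_step S m ([] @ concat (replicate k [s, t]) @ []) ([] @ [])"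
    by (rule word_step.relator) (use assms in auto)
  then have "word_class S m (concat (replicate k [s, t])) = word_class S m []"
    using lr by (subst word_class_eq_iff) (auto intro: r_into_equivclp)
  then show ?thesis unfolding st pw by (simp add: coxeter_group_def)
qed

lemma coxeter_group_universal:
  assumes G: "group G" and f: "f \<in> S \<rightarrow> carrier G"
    and rel: "\<And>s t k. \<lbrakk>s \<in> S; t \<in> S; m s t = enat k\<rbrakk> \<Longrightarrow> (f s \<otimes>\<^bsub>G\<^esub> f t) [^]\<^bsub>G\<^esub> k = \<one>\<^bsub>G\<^esub>"
  shows "\<exists>h \<in> hom (coxeter_group S m) G. \<forall>s\<in>S. h (generator S m s) = f s"
proof -
  interpret G: group G by fact
  define e where "e xs = foldr (\<lambda>s g. f s \<otimes>\<^bsub>G\<^esub> g) xs \<one>\<^bsub>G\<^esub>" for xs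
  have ec: "e xs \<in> carrier G" if "xs \<in> lists S" for xs
    using that f by (induction xs) (auto simp: e_def)
  have ea: "e (xs @ ys) = e xs \<otimes>\<^bsub>G\<^esub> e ys" if "xs \<in> lists S" "ys \<in> lists S" for xs ys
    using that(1)
  proof (induction xs)
    case Nil
    then show ?case using ec[OF that(2)] by (simp add: e_def)
  next
    case (Cons a xs)
    have "e ((a # xs) @ ys) = f a \<otimes>\<^bsub>G\<^esub> e (xs @ ys)" by (simp add: e_def)
    also have "\<dots> = f a \<otimes>\<^bsub>G\<^esub> e xs \<otimes>\<^bsub>G\<^esub> e ys"
      using Cons ec that f by (auto simp: G.m_assoc Pi_iff)
    finally show ?case by (simp add: e_def)
  qed
  have lr: "concat (replicate n [s, t]) \<in> lists S" if "s \<in> S" "t \<in> S" for n s t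
    using that by (induction n) auto
  have ep: "e (concat (replicate n [s, t])) = (f s \<otimes>\<^bsub>G\<^esub> f t) [^]\<^bsub>G\<^esub> n" if "s \<in> S" "t \<in> S" for n s t
  proof (induction n)
    case 0
    show ?case by (simp add: e_def)
  next
    case (Suc n)
    have fc: "f s \<in> carrier G" "f t \<in> carrier G" using f that by auto
    have "e (concat (replicate (Suc n) [s, t])) = e [s, t] \<otimes>\<^bsub>G\<^esub> e (concat (replicate n [s, t]))"
      using ea[of "[s, t]" "concat (replicate n [s, t])"] lr[OF that] that by simp
    also have "\<dots> = (f s \<otimes>\<^bsub>G\<^esub> f t) \<otimes>\<^bsub>G\<^esub> (f s \<otimes>\<^bsub>G\<^esub> f t) [^]\<^bsub>G\<^esub> n"
      unfolding Suc using fc by (simp add: e_def)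
    also have "\<dots> = (f s \<otimes>\<^bsub>G\<^esub> f t) [^]\<^bsub>G\<^esub> Suc n"
      using fc by (simp only: G.nat_pow_Suc2 G.m_closed)
    finally show ?case .
  qed
  have es: "e x = e y" if "word_step S m x y" for x y
    using that
  proof cases
    case (relator s t k xs ys)
    have "e (concat (replicate k [s, t])) = \<one>\<^bsub>G\<^esub>"
      using ep rel relator by simp
    then show ?thesis
      using relator lr[of s t k] ea ec by auto
  qed
  have ee: "e x = e y" if "equivclp (word_step S m) x y" for x y
    using that by (induction rule: equivclp_induct) (auto dest: es)
  define h where "h X = e (SOME x. x \<in> X)" for X
  have he: "h (word_class S m x) = e x" if "x \<in> lists S" for x
  proof -
    have "x \<in> word_class S m x" using that by (simp add: word_class_def)
    then have "(SOME y. y \<in> word_class S m x) \<in> word_class S m x" by (rule someI)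
    then show ?thesis unfolding h_def using ee by (auto simp: word_class_def)
  qed
  have "h \<in> hom (coxeter_group S m) G"
  proof (rule homI)
    fix x y assume "x \<in> carrier (coxeter_group S m)" "y \<in> carrier (coxeter_group S m)"
    then obtain a b where ab: "a \<in> lists S" "b \<in> lists S" "x = word_class S m a" "y = word_class S m b"
      by (auto simp: coxeter_group_def)
    then show "h (x \<otimes>\<^bsub>coxeter_group S m\<^esub> y) = h x \<otimes>\<^bsub>G\<^esub> h y"
      by (simp add: word_class_mult he ea)
  next
    fix x assume "x \<in> carrier (coxeter_group S m)"
    then obtain a where "a \<in> lists S" "x = word_class S m a"
      by (auto simp: coxeter_group_def)
    then show "h x \<in> carrier G" using he ec by simp
  qed
  moreover have "h (generator S m s) = f s" if "s \<in> S" for s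
  proof -
    have "h (generator S m s) = f s \<otimes>\<^bsub>G\<^esub> \<one>\<^bsub>G\<^esub>"
      using that he[of "[s]"] by (simp add: generator_def e_def)
    also have "\<dots> = f s"
      by (rule G.r_one) (use f that in blast)
    finally show ?thesis .
  qed
  ultimately show ?thesis by blast
qed

end


section \<open>Groupoids\<close>

record ('v, 'e) groupoid =
  vertices :: "'v set"
  edges :: "'e set"
  src :: "'e \<Rightarrow> 'v"
  tgt :: "'e \<Rightarrow> 'v"
  ident :: "'v \<Rightarrow> 'e"
  gcomp :: "'e \<Rightarrow> 'e \<Rightarrow> 'e"
  ginv :: "'e \<Rightarrow> 'e"

text \<open>\<open>gcomp G g h\<close> is \<open>g;h\<close>, written from left to right; its value is irrelevant
  unless \<open>tgt G g = src G h\<close>.\<close>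

locale groupoid =
  fixes G :: "('v, 'e) groupoid"
  assumes nonempty: "vertices G \<noteq> {}"
    and init_in: "g \<in> edges G \<Longrightarrow> src G g \<in> vertices G"
    and term_in: "g \<in> edges G \<Longrightarrow> tgt G g \<in> vertices G"
    and ident_in: "C \<in> vertices G \<Longrightarrow> ident G C \<in> edges G"
    and init_ident: "C \<in> vertices G \<Longrightarrow> src G (ident G C) = C"
    and term_ident: "C \<in> vertices G \<Longrightarrow> tgt G (ident G C) = C"
    and comp_in: "\<lbrakk>g \<in> edges G; h \<in> edges G; tgt G g = src G h\<rbrakk> \<Longrightarrow> gcomp G g h \<in> edges G"
    and init_comp: "\<lbrakk>g \<in> edges G; h \<in> edges G; tgt G g = src G h\<rbrakk> \<Longrightarrow>
      src G (gcomp G g h) = src G g"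
    and term_comp: "\<lbrakk>g \<in> edges G; h \<in> edges G; tgt G g = src G h\<rbrakk> \<Longrightarrow>
      tgt G (gcomp G g h) = tgt G h"
    and comp_assoc: "\<lbrakk>f \<in> edges G; g \<in> edges G; h \<in> edges G;
        tgt G f = src G g; tgt G g = src G h\<rbrakk> \<Longrightarrow>
      gcomp G (gcomp G f g) h = gcomp G f (gcomp G g h)"
    and ident_comp: "g \<in> edges G \<Longrightarrow> gcomp G (ident G (src G g)) g = g"
    and comp_ident: "g \<in> edges G \<Longrightarrow> gcomp G g (ident G (tgt G g)) = g"
    and inv_in: "g \<in> edges G \<Longrightarrow> ginv G g \<in> edges G"
    and init_inv: "g \<in> edges G \<Longrightarrow> src G (ginv G g) = tgt G g"
    and term_inv: "g \<in> edges G \<Longrightarrow> tgt G (ginv G g) = src G g"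
    and comp_inv: "g \<in> edges G \<Longrightarrow> gcomp G g (ginv G g) = ident G (src G g)"
    and inv_comp: "g \<in> edges G \<Longrightarrow> gcomp G (ginv G g) g = ident G (tgt G g)"

definition is_identity :: "('v, 'e) groupoid \<Rightarrow> 'e \<Rightarrow> bool" where
  "is_identity G g \<longleftrightarrow> (\<exists>C\<in>vertices G. g = ident G C)"

definition component :: "('v, 'e) groupoid \<Rightarrow> 'v \<Rightarrow> ('v, 'e) groupoid" where
  "component G C =
    (let V = {D. \<exists>g\<in>edges G. src G g = C \<and> tgt G g = D}
     in G\<lparr>vertices := V, edges := {g \<in> edges G. src G g \<in> V \<and> tgt G g \<in> V}\<rparr>)"

definition trivial_groupoid :: "('v, 'e) groupoid \<Rightarrow> bool" where
  "trivial_groupoid G \<longleftrightarrow> (\<exists>C g. vertices G = {C} \<and> edges G = {g})"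


section \<open>Generalized chamber systems and galleries\<close>

record ('s, 'v, 'e) chamber_system =
  chambers :: "'v set"
  panel_groupoid :: "'s \<Rightarrow> ('v, 'e) groupoid"

definition generalized_chamber_system :: "'s set \<Rightarrow> ('s, 'v, 'e, 'z) chamber_system_scheme \<Rightarrow> bool" where
  "generalized_chamber_system S \<W> \<longleftrightarrow>
    (\<forall>s\<in>S. groupoid (panel_groupoid \<W> s) \<and> vertices (panel_groupoid \<W> s) = chambers \<W>)"

text \<open>Edges of the chamber system are tagged by their type, so that edges of different types are
  distinct even if the panel groupoids share edges.  A gallery is its initial chamber together
  with its list of edges.\<close>

type_synonym ('s, 'v, 'e) gallery = "'v \<times> ('s \<times> 'e) list"

definition typed_edge :: "'s set \<Rightarrow> ('s, 'v, 'e, 'z) chamber_system_scheme \<Rightarrow> 's \<times> 'e \<Rightarrow> bool" where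
  "typed_edge S \<W> i \<longleftrightarrow> fst i \<in> S \<and> snd i \<in> edges (panel_groupoid \<W> (fst i)) \<and>
    \<not> is_identity (panel_groupoid \<W> (fst i)) (snd i)"

definition edge_init :: "('s, 'v, 'e, 'z) chamber_system_scheme \<Rightarrow> 's \<times> 'e \<Rightarrow> 'v" where
  "edge_init \<W> i = src (panel_groupoid \<W> (fst i)) (snd i)"

definition edge_term :: "('s, 'v, 'e, 'z) chamber_system_scheme \<Rightarrow> 's \<times> 'e \<Rightarrow> 'v" where
  "edge_term \<W> i = tgt (panel_groupoid \<W> (fst i)) (snd i)"

fun edge_path :: "'s set \<Rightarrow> ('s, 'v, 'e, 'z) chamber_system_scheme \<Rightarrow> 'v \<Rightarrow> ('s \<times> 'e) list \<Rightarrow> bool" where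
  "edge_path S \<W> C [] \<longleftrightarrow> C \<in> chambers \<W>"
| "edge_path S \<W> C (i # js) \<longleftrightarrow>
    typed_edge S \<W> i \<and> edge_init \<W> i = C \<and> edge_path S \<W> (edge_term \<W> i) js"

definition gallery :: "'s set \<Rightarrow> ('s, 'v, 'e, 'z) chamber_system_scheme \<Rightarrow> ('s, 'v, 'e) gallery \<Rightarrow> bool" where
  "gallery S \<W> \<beta> \<longleftrightarrow> edge_path S \<W> (fst \<beta>) (snd \<beta>)"

definition gal_init :: "('s, 'v, 'e) gallery \<Rightarrow> 'v" where
  "gal_init \<beta> = fst \<beta>"

definition gal_term :: "('s, 'v, 'e, 'z) chamber_system_scheme \<Rightarrow> ('s, 'v, 'e) gallery \<Rightarrow> 'v" where
  "gal_term \<W> \<beta> = (if snd \<beta> = [] then fst \<beta> else edge_term \<W> (last (snd \<beta>)))"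

definition gal_type :: "('s, 'v, 'e) gallery \<Rightarrow> 's list" where
  "gal_type \<beta> = map fst (snd \<beta>)"

definition W_length :: "'s set \<Rightarrow> ('s \<Rightarrow> 's \<Rightarrow> enat) \<Rightarrow> ('s, 'v, 'e) gallery \<Rightarrow> 's list set" where
  "W_length S m \<beta> = word_class S m (gal_type \<beta>)"

definition geodesic :: "'s set \<Rightarrow> ('s \<Rightarrow> 's \<Rightarrow> enat) \<Rightarrow> ('s, 'v, 'e, 'z) chamber_system_scheme \<Rightarrow>
    ('s, 'v, 'e) gallery \<Rightarrow> bool" where
  "geodesic S m \<W> \<beta> \<longleftrightarrow> gallery S \<W> \<beta> \<and> reduced_word S m (gal_type \<beta>)"

definition maximal_geodesic :: "'s set \<Rightarrow> ('s \<Rightarrow> 's \<Rightarrow> enat) \<Rightarrow>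
    ('s, 'v, 'e, 'z) chamber_system_scheme \<Rightarrow> 's \<Rightarrow> 's \<Rightarrow> ('s, 'v, 'e) gallery \<Rightarrow> bool" where
  "maximal_geodesic S m \<W> s t \<beta> \<longleftrightarrow>
    gallery S \<W> \<beta> \<and> gal_type \<beta> = alt_word (the_enat (m s t)) s t"

definition st_cycle :: "'s set \<Rightarrow> ('s \<Rightarrow> 's \<Rightarrow> enat) \<Rightarrow>
    ('s, 'v, 'e, 'z) chamber_system_scheme \<Rightarrow> 's \<Rightarrow> 's \<Rightarrow> ('s, 'v, 'e) gallery \<Rightarrow> bool" where
  "st_cycle S m \<W> s t \<beta> \<longleftrightarrow>
    gallery S \<W> \<beta> \<and> gal_init \<beta> = gal_term \<W> \<beta> \<and>
    gal_type \<beta> = alt_word (2 * the_enat (m s t)) s t"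

definition finite_pair :: "'s set \<Rightarrow> ('s \<Rightarrow> 's \<Rightarrow> enat) \<Rightarrow> 's \<Rightarrow> 's \<Rightarrow> bool" where
  "finite_pair S m s t \<longleftrightarrow> s \<in> S \<and> t \<in> S \<and> s \<noteq> t \<and> m s t \<noteq> \<infinity>"


section \<open>Weyl data, homotopy and Weyl graphs\<close>

record ('s, 'v, 'e) weyl_data = "('s, 'v, 'e) chamber_system" +
  suites :: "'s \<Rightarrow> 's \<Rightarrow> ('s, 'v, 'e) gallery set"

definition is_weyl_data :: "'s set \<Rightarrow> ('s \<Rightarrow> 's \<Rightarrow> enat) \<Rightarrow> ('s, 'v, 'e) weyl_data \<Rightarrow> bool" where
  "is_weyl_data S m \<W> \<longleftrightarrow> generalized_chamber_system S \<W> \<and>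
    (\<forall>s t. finite_pair S m s t \<longrightarrow> (\<forall>\<beta>\<in>suites \<W> s t. st_cycle S m \<W> s t \<beta>))"

inductive elementary_homotopy ::
    "'s set \<Rightarrow> ('s \<Rightarrow> 's \<Rightarrow> enat) \<Rightarrow> ('s, 'v, 'e) weyl_data \<Rightarrow>
      ('s, 'v, 'e) gallery \<Rightarrow> ('s, 'v, 'e) gallery \<Rightarrow> bool"
  for S :: "'s set" and m :: "'s \<Rightarrow> 's \<Rightarrow> enat" and \<W> :: "('s, 'v, 'e) weyl_data"
  where
    cancel: "gallery S \<W> (C, \<alpha> @ [(s, i), (s, ginv (panel_groupoid \<W> s) i)] @ \<beta>) \<Longrightarrow>
      elementary_homotopy S m \<W>
        (C, \<alpha> @ [(s, i), (s, ginv (panel_groupoid \<W> s) i)] @ \<beta>) (C, \<alpha> @ \<beta>)"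
  | compose: "\<lbrakk>gallery S \<W> (C, \<alpha> @ [(s, i), (s, i')] @ \<beta>);
        i' \<noteq> ginv (panel_groupoid \<W> s) i\<rbrakk> \<Longrightarrow>
      elementary_homotopy S m \<W>
        (C, \<alpha> @ [(s, i), (s, i')] @ \<beta>) (C, \<alpha> @ [(s, gcomp (panel_groupoid \<W> s) i i')] @ \<beta>)"
  | suite: "\<lbrakk>gallery S \<W> (C, \<alpha> @ \<sigma> @ \<beta>); finite_pair S m s t; (D, \<sigma>) \<in> suites \<W> s t\<rbrakk> \<Longrightarrow>
      elementary_homotopy S m \<W> (C, \<alpha> @ \<sigma> @ \<beta>) (C, \<alpha> @ \<beta>)"

definition homotopic ::
    "'s set \<Rightarrow> ('s \<Rightarrow> 's \<Rightarrow> enat) \<Rightarrow> ('s, 'v, 'e) weyl_data \<Rightarrow>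
      ('s, 'v, 'e) gallery \<Rightarrow> ('s, 'v, 'e) gallery \<Rightarrow> bool" where
  "homotopic S m \<W> = equivclp (elementary_homotopy S m \<W>)"

definition pre_weyl_graph :: "'s set \<Rightarrow> ('s \<Rightarrow> 's \<Rightarrow> enat) \<Rightarrow> ('s, 'v, 'e) weyl_data \<Rightarrow> bool" where
  "pre_weyl_graph S m \<W> \<longleftrightarrow>
    is_weyl_data S m \<W> \<and>
    (\<forall>s\<in>S. \<forall>C\<in>chambers \<W>. \<not> trivial_groupoid (component (panel_groupoid \<W> s) C)) \<and>
    (\<forall>s t \<beta>. finite_pair S m s t \<and> maximal_geodesic S m \<W> s t \<beta> \<longrightarrow>
      (\<exists>\<gamma>. maximal_geodesic S m \<W> t s \<gamma> \<and> homotopic S m \<W> \<beta> \<gamma>))"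

definition weyl_graph :: "'s set \<Rightarrow> ('s \<Rightarrow> 's \<Rightarrow> enat) \<Rightarrow> ('s, 'v, 'e) weyl_data \<Rightarrow> bool" where
  "weyl_graph S m \<W> \<longleftrightarrow>
    pre_weyl_graph S m \<W> \<and>
    (\<forall>\<beta> \<gamma>. geodesic S m \<W> \<beta> \<and> geodesic S m \<W> \<gamma> \<and> homotopic S m \<W> \<beta> \<gamma> \<longrightarrow>
      W_length S m \<beta> = W_length S m \<gamma>)"


section \<open>W-groupoids and their associated Weyl data\<close>

locale W_groupoid = coxeter_matrix S m + groupoid G
  for S :: "'s set" and m :: "'s \<Rightarrow> 's \<Rightarrow> enat" and G :: "('v, 'e) groupoid" +
  fixes \<delta> :: "'e \<Rightarrow> 's list set"
  assumes delta_in: "g \<in> edges G \<Longrightarrow> \<delta> g \<in> carrier (coxeter_group S m)"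
    and weak: "\<lbrakk>C \<in> vertices G; s \<in> S\<rbrakk> \<Longrightarrow>
      \<exists>g\<in>edges G. src G g = C \<and> \<delta> g = generator S m s"
    and WG1: "C \<in> vertices G \<Longrightarrow> \<delta> (ident G C) = \<one>\<^bsub>coxeter_group S m\<^esub>"
    and WG2: "\<lbrakk>g \<in> edges G; h \<in> edges G; tgt G g = src G h\<rbrakk> \<Longrightarrow>
      bruhat_le S m (\<delta> g \<otimes>\<^bsub>coxeter_group S m\<^esub> \<delta> h) (\<delta> (gcomp G g h))"
    and WG3: "\<lbrakk>g \<in> edges G; s \<in> S;
        bruhat_less S m (\<delta> g \<otimes>\<^bsub>coxeter_group S m\<^esub> generator S m s) (\<delta> g)\<rbrakk> \<Longrightarrow>
      \<exists>h\<in>edges G. src G h = src G g \<and> \<delta> (gcomp G (ginv G h) g) = generator S m s \<and>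
        \<delta> h = \<delta> g \<otimes>\<^bsub>coxeter_group S m\<^esub> generator S m s"

locale strict_W_groupoid = W_groupoid S m G \<delta>
  for S :: "'s set" and m :: "'s \<Rightarrow> 's \<Rightarrow> enat" and G :: "('v, 'e) groupoid"
    and \<delta> :: "'e \<Rightarrow> 's list set" +
  assumes strict: "\<lbrakk>g \<in> edges G; \<delta> g = \<one>\<^bsub>coxeter_group S m\<^esub>\<rbrakk> \<Longrightarrow> is_identity G g"

definition parabolic_groupoid :: "'s set \<Rightarrow> ('s \<Rightarrow> 's \<Rightarrow> enat) \<Rightarrow> ('v, 'e) groupoid \<Rightarrow>
    ('e \<Rightarrow> 's list set) \<Rightarrow> 's \<Rightarrow> ('v, 'e) groupoid" where
  "parabolic_groupoid S m G \<delta> s =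
    G\<lparr>edges := {g \<in> edges G. \<delta> g \<in> {\<one>\<^bsub>coxeter_group S m\<^esub>, generator S m s}}\<rparr>"

definition associated_chamber_system :: "'s set \<Rightarrow> ('s \<Rightarrow> 's \<Rightarrow> enat) \<Rightarrow> ('v, 'e) groupoid \<Rightarrow>
    ('e \<Rightarrow> 's list set) \<Rightarrow> ('s, 'v, 'e) chamber_system" where
  "associated_chamber_system S m G \<delta> =
    \<lparr>chambers = vertices G, panel_groupoid = parabolic_groupoid S m G \<delta>\<rparr>"

fun path_comp :: "('v, 'e) groupoid \<Rightarrow> 'v \<Rightarrow> 'e list \<Rightarrow> 'e" where
  "path_comp G C [] = ident G C"
| "path_comp G C (g # gs) = gcomp G g (path_comp G (tgt G g) gs)"

definition associated_weyl_data :: "'s set \<Rightarrow> ('s \<Rightarrow> 's \<Rightarrow> enat) \<Rightarrow> ('v, 'e) groupoid \<Rightarrow>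
    ('e \<Rightarrow> 's list set) \<Rightarrow> ('s, 'v, 'e) weyl_data" where
  "associated_weyl_data S m G \<delta> =
    \<lparr>chambers = vertices G, panel_groupoid = parabolic_groupoid S m G \<delta>,
     suites = (\<lambda>s t. {\<beta>. finite_pair S m s t \<and>
        st_cycle S m (associated_chamber_system S m G \<delta>) s t \<beta> \<and>
        is_identity G (path_comp G (gal_init \<beta>) (map snd (snd \<beta>)))})\<rparr>"

end

theory Submission
  imports Defs Complex_Main
begin

text \<open>
  Two facts drive the proof.  First, alternating words of length \<open>m s t\<close> are reduced: the dual
  geometric representation shows that \<open>st\<close> has order exactly \<open>m s t\<close>, so the reflections attached
  to the letters of such a word are distinct, and their number bounds the length from below.
  Second, comparing lengths in WG2 for the products \<open>gh\<close> and \<open>(gh)h\<inverse>\<close> gives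
  \<open>\<delta> (gh) = \<delta> g s\<close> whenever \<open>\<delta> h = s\<close> and \<open>\<delta> g s\<close> is longer than \<open>\<delta> g\<close>; hence the composite
  of a geodesic has its \<open>W\<close>-length as distance.  As homotopies preserve composites, this is axiom W.
  Conversely WG3 factors an edge along any reduced word for its distance; factoring the
  composite of a maximal \<open>(s,t)\<close>-geodesic along \<open>p(t,s)\<close> yields a defining suite and so PW1.
\<close>

section \<open>Words in a Coxeter group\<close>

lemma concat_replicate_pair: "concat (replicate n [s, t]) = alt_word (2 * n) s t"
  by (induction n) auto

lemma set_alt_word: "set (alt_word n s t) \<subseteq> {s, t}"
  by (induction n s t rule: alt_word.induct) auto

lemma length_alt_word [simp]: "length (alt_word n s t) = n"
  by (induction n s t rule: alt_word.induct) auto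

lemma alt_word_add_even: "alt_word (2 * i + j) s t = alt_word (2 * i) s t @ alt_word j s t"
  by (induction i) auto

text \<open>For \<open>n > 0\<close> the words \<open>alt_word n s t\<close> and
  \<open>alt_word n t s\<close> end in different letters, so the juncture still alternates. This
  serves both the braid relation and the type of a defining suite.\<close>

lemma alt_word_append_rev:
  "alt_word n s t @ rev (alt_word n t s) = alt_word (2 * n) s t"
proof (induction n arbitrary: s t)
  case (Suc n)
  have "alt_word (Suc n) s t @ rev (alt_word (Suc n) t s) = s # alt_word (2 * n) t s @ [t]"
    using Suc[of t s] by simp
  also have "\<dots> = s # alt_word (2 * n + 1) t s"
    by (simp only: alt_word_add_even) simp
  finally show ?case by simp
qed simp

lemma rev_in_lists [simp]: "rev x \<in> lists A \<longleftrightarrow> x \<in> lists A"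
  by (simp add: in_lists_conv_set)

lemma distinct_count_list1: "distinct x \<Longrightarrow> a \<in> set x \<Longrightarrow> count_list x a = 1"
  by (induction x) auto

text \<open>The reflections \<open>s\<^sub>1\<dots>s\<^sub>i\<dots>s\<^sub>1\<close> of a word \<open>s\<^sub>1\<dots>s\<^sub>n\<close>.  The set of those that occur an
  odd number of times depends only on the group element, so its size bounds the length from below.\<close>

fun refls :: "'s list \<Rightarrow> 's list list" where
  "refls [] = []"
| "refls (s # x) = [s] # map (\<lambda>r. s # r @ [s]) (refls x)"

lemma length_refls [simp]: "length (refls x) = length x"
  by (induction x) auto

lemma refls_append: "refls (x @ y) = refls x @ map (\<lambda>r. x @ r @ rev x) (refls y)"
  by (induction x) (auto simp: o_def)

lemma refls_in_lists: "x \<in> lists A \<Longrightarrow> r \<in> set (refls x) \<Longrightarrow> r \<in> lists A"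
  by (induction x arbitrary: r) fastforce+

text \<open>A letter conjugated by the alternating prefix before it continues the alternation, which
  makes the reflection at position \<open>i\<close> an alternating word of odd length.\<close>

lemma refls_alt_word: "refls (alt_word n s t) = map (\<lambda>i. alt_word (2 * i + 1) s t) [0..<n]"
proof (induction n s t rule: alt_word.induct)
  case (2 n s t)
  have "s # alt_word (2 * i + 1) t s @ [s] = alt_word (2 * Suc i + 1) s t" for i
  proof -
    have "alt_word (2 * Suc i + 1) s t = alt_word (2 * Suc i) s t @ [s]"
      by (simp only: alt_word_add_even) simp
    then show ?thesis by simp
  qed
  then show ?case
    using 2 by (simp add: upt_conv_Cons map_Suc_upt[symmetric] o_def del: upt_Suc)
qed simp

context coxeter_matrix
begin

abbreviation "cls \<equiv> word_class S m"

lemma alt_word_in_lists [simp]: "s \<in> S \<Longrightarrow> t \<in> S \<Longrightarrow> alt_word n s t \<in> lists S"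
  using set_alt_word[of n s t] by auto

lemma word_class_append_cong:
  assumes "cls x = cls x'" "cls y = cls y'" "x \<in> lists S" "x' \<in> lists S" "y \<in> lists S" "y' \<in> lists S"
  shows "cls (x @ y) = cls (x' @ y')"
  using word_class_mult[of x S y m] word_class_mult[of x' S y' m] assms by simp

lemma word_class_relator:
  assumes "s \<in> S" "t \<in> S" "m s t = enat k"
  shows "cls (alt_word (2 * k) s t) = cls []"
proof -
  have "word_step S m ([] @ concat (replicate k [s, t]) @ []) ([] @ [])"
    by (rule word_step.relator) (use assms in auto)
  then show ?thesis
    using assms by (subst word_class_eq_iff) (auto simp: concat_replicate_pair)
qed

lemma word_class_square: "s \<in> S \<Longrightarrow> cls [s, s] = cls []"
  using word_class_relator[of s s 1] diag[of s] by (simp add: one_enat_def numeral_2_eq_2)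

lemma word_class_append_rev: "x \<in> lists S \<Longrightarrow> cls (x @ rev x) = cls []"
proof (induction x)
  case (Cons a x)
  then have "cls ([a] @ (x @ rev x) @ [a]) = cls ([a] @ [] @ [a])"
    by (intro word_class_append_cong) auto
  then show ?case using Cons word_class_square[of a] by simp
qed simp

text \<open>Classes are generated by single deletions of relators. Three invariants rely on this:
  the parity of the length, the action \<open>act\<close> and the parities of reflection
  counts.\<close>

lemma word_class_invariant:
  assumes "cls x = cls y" "x \<in> lists S" "y \<in> lists S"
    and "\<And>x y. word_step S m x y \<Longrightarrow> f x = f y"
  shows "f x = f y"
proof -
  have "equivclp (word_step S m) x y" using assms by (simp add: word_class_eq_iff)
  then show ?thesis
    by (induction rule: equivclp_induct) (auto dest: assms(4))
qed

lemma word_class_even_length: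
  assumes "cls x = cls y" "x \<in> lists S" "y \<in> lists S"
  shows "even (length x) = even (length y)"
proof (rule word_class_invariant[OF assms])
  fix x y assume "word_step S m x y"
  then show "even (length x) = even (length y)"
    by cases (auto simp: concat_replicate_pair)
qed

section \<open>Coxeter length and Bruhat order\<close>

definition wlen :: "'s list set \<Rightarrow> nat" where
  "wlen w = (LEAST n. \<exists>x\<in>lists S. cls x = w \<and> length x = n)"

lemma wlen_le: "x \<in> lists S \<Longrightarrow> wlen (cls x) \<le> length x"
  unfolding wlen_def by (rule Least_le) auto

lemma reduced_word_iff_wlen: "reduced_word S m x \<longleftrightarrow> x \<in> lists S \<and> wlen (cls x) = length x"
proof -
  have "\<exists>y\<in>lists S. cls y = cls x \<and> length y = wlen (cls x)" if "x \<in> lists S"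
    unfolding wlen_def by (rule LeastI) (use that in auto)
  then show ?thesis
    unfolding reduced_word_def using wlen_le
    by (metis order_antisym order_trans order_refl)
qed

lemma reduced_word_exists:
  assumes "w \<in> carrier (coxeter_group S m)"
  obtains x where "reduced_word S m x" "cls x = w" "x \<in> lists S" "length x = wlen w"
proof -
  have "\<exists>n. \<exists>x\<in>lists S. cls x = w \<and> length x = n"
    using assms by (auto simp: coxeter_group_def)
  then have "\<exists>x\<in>lists S. cls x = w \<and> length x = wlen w"
    unfolding wlen_def by (rule LeastI_ex)
  then show thesis using that reduced_word_iff_wlen by auto
qed

text \<open>A word for \<open>u\<close> is a subword of a reduced word for \<open>w\<close>; equal
  lengths force it to be the whole word. In this form WG2 becomes a comparison of lengths.\<close>

lemma bruhat_le_wlen: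
  assumes "bruhat_le S m u w"
  shows "wlen u \<le> wlen w" and "wlen u = wlen w \<Longrightarrow> u = w"
proof -
  obtain x y where xy: "reduced_word S m x" "cls x = w" "subseq y x" "cls y = u"
    using assms by (auto simp: bruhat_le_def)
  have x: "x \<in> lists S" using xy(1) by (simp add: reduced_word_def)
  have "set y \<subseteq> set x" using xy(3) by (metis set_nths_subset subseq_conv_nths)
  then have y: "y \<in> lists S" using x by (simp add: in_lists_conv_set subset_iff)
  have l: "length y \<le> length x" using xy(3) by (rule list_emb_length)
  have u: "wlen u \<le> length y" using wlen_le[OF y] xy(4) by simp
  have w: "wlen w = length x" using xy(1) by (simp add: reduced_word_iff_wlen flip: xy(2))
  show "wlen u \<le> wlen w" using l u w by simp
  assume "wlen u = wlen w"
  then have "length y = length x" using l u w by linarith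
  then have "y = x" by (rule subseq_same_length[OF xy(3)])
  then show "u = w" using xy(2,4) by simp
qed

lemma wlen_one [simp]: "wlen (cls []) = 0"
  using wlen_le[of "[]"] by simp

lemma wlen_eq_0: "w \<in> carrier (coxeter_group S m) \<Longrightarrow> wlen w = 0 \<Longrightarrow> w = cls []"
  by (metis length_0_conv reduced_word_exists)

lemma wlen_generator: "s \<in> S \<Longrightarrow> wlen (cls [s]) = 1"
proof -
  assume s: "s \<in> S"
  then have "cls [s] \<noteq> cls []" using word_class_even_length[of "[s]" "[]"] by auto
  moreover have "cls [s] \<in> carrier (coxeter_group S m)" using s by (auto simp: coxeter_group_def)
  ultimately have "wlen (cls [s]) \<noteq> 0" using wlen_eq_0 by blast
  moreover have "wlen (cls [s]) \<le> 1" using wlen_le[of "[s]"] s by simp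
  ultimately show ?thesis by simp
qed

lemma one_eq_cls: "\<one>\<^bsub>coxeter_group S m\<^esub> = cls []"
  by (simp add: coxeter_group_def)

lemma cls_in_carrier: "x \<in> lists S \<Longrightarrow> cls x \<in> carrier (coxeter_group S m)"
  by (auto simp: coxeter_group_def)

lemma cls_one_neq_generator: "s \<in> S \<Longrightarrow> cls [s] \<noteq> cls []"
  using wlen_generator[of s] by auto

lemma cls_generator_square:
  "s \<in> S \<Longrightarrow> cls [s] \<otimes>\<^bsub>coxeter_group S m\<^esub> cls [s] = \<one>\<^bsub>coxeter_group S m\<^esub>"
  by (simp add: word_class_mult word_class_square one_eq_cls)

lemma mult_generator_twice:
  assumes "w \<in> carrier (coxeter_group S m)" "s \<in> S"
  shows "w \<otimes>\<^bsub>coxeter_group S m\<^esub> cls [s] \<otimes>\<^bsub>coxeter_group S m\<^esub> cls [s] = w"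
proof -
  interpret W: group "coxeter_group S m" by (rule group_coxeter_group)
  show ?thesis
    using assms by (simp add: W.m_assoc cls_in_carrier cls_generator_square)
qed

text \<open>A shorter word for the class of \<open>x\<close>, extended by \<open>s\<close>, would
  shorten \<open>x @ [s]\<close>.\<close>

lemma reduced_word_butlast:
  assumes "reduced_word S m (x @ [s])"
  shows "reduced_word S m x"
proof -
  have l: "x \<in> lists S" "s \<in> S" "wlen (cls (x @ [s])) = length x + 1"
    using assms by (auto simp: reduced_word_iff_wlen)
  then have c: "cls x \<in> carrier (coxeter_group S m)" by (auto simp: coxeter_group_def)
  obtain y where "reduced_word S m y" and y: "cls y = cls x" "y \<in> lists S" "length y = wlen (cls x)"
    by (rule reduced_word_exists[OF c])
  have "cls (y @ [s]) = cls (x @ [s])" using l y by (intro word_class_append_cong) auto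
  moreover have "y @ [s] \<in> lists S" using y(2) l(2) by simp
  ultimately have "wlen (cls (x @ [s])) \<le> length (y @ [s])" using wlen_le by metis
  then have "wlen (cls x) = length x" using y(3) l(3) wlen_le[OF l(1)] by simp
  then show ?thesis using l(1) by (simp add: reduced_word_iff_wlen)
qed

text \<open>A shortest word for \<open>ws\<close>, followed by \<open>s\<close>, is a word for
  \<open>w\<close>.\<close>

lemma wlen_mult_generator_le:
  assumes "w \<in> carrier (coxeter_group S m)" "s \<in> S"
  shows "wlen w \<le> wlen (w \<otimes>\<^bsub>coxeter_group S m\<^esub> cls [s]) + 1"
proof -
  interpret W: group "coxeter_group S m" by (rule group_coxeter_group)
  have s: "cls [s] \<in> carrier (coxeter_group S m)" using assms by (auto simp: coxeter_group_def)
  have c: "w \<otimes>\<^bsub>coxeter_group S m\<^esub> cls [s] \<in> carrier (coxeter_group S m)"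
    using assms(1) s by (rule W.m_closed)
  obtain y where "reduced_word S m y" and y: "cls y = w \<otimes>\<^bsub>coxeter_group S m\<^esub> cls [s]" "y \<in> lists S"
      "length y = wlen (w \<otimes>\<^bsub>coxeter_group S m\<^esub> cls [s])"
    by (rule reduced_word_exists[OF c])
  have "cls (y @ [s]) = w \<otimes>\<^bsub>coxeter_group S m\<^esub> (cls [s] \<otimes>\<^bsub>coxeter_group S m\<^esub> cls [s])"
    using y assms s by (simp add: word_class_mult[symmetric] W.m_assoc)
  also have "cls [s] \<otimes>\<^bsub>coxeter_group S m\<^esub> cls [s] = \<one>\<^bsub>coxeter_group S m\<^esub>"
    using assms by (simp add: word_class_mult word_class_square) (simp add: coxeter_group_def)
  finally have "cls (y @ [s]) = w" using assms(1) by simp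
  moreover have "y @ [s] \<in> lists S" using y(2) assms(2) by simp
  ultimately have "wlen w \<le> length (y @ [s])" using wlen_le by metis
  then show ?thesis using y(3) by simp
qed

text \<open>The last letter of a reduced word is a descent, as WG3 requires.\<close>

lemma descent_bruhat_less:
  assumes "reduced_word S m (x @ [s])"
  shows "bruhat_less S m (cls (x @ [s]) \<otimes>\<^bsub>coxeter_group S m\<^esub> generator S m s) (cls (x @ [s]))"
    and "cls (x @ [s]) \<otimes>\<^bsub>coxeter_group S m\<^esub> generator S m s = cls x"
proof -
  have l: "x \<in> lists S" "s \<in> S" using assms by (auto simp: reduced_word_def)
  have "cls (x @ [s]) = cls x \<otimes>\<^bsub>coxeter_group S m\<^esub> cls [s]" using l by (simp add: word_class_mult)
  then show eq: "cls (x @ [s]) \<otimes>\<^bsub>coxeter_group S m\<^esub> generator S m s = cls x"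
    using mult_generator_twice[OF cls_in_carrier[OF l(1)] l(2)] by (simp add: generator_def)
  have "subseq x (x @ [s])" by (simp add: prefix_imp_subseq)
  moreover have "cls x \<noteq> cls (x @ [s])"
    using assms wlen_le[OF l(1)] by (auto simp: reduced_word_iff_wlen)
  ultimately show "bruhat_less S m (cls (x @ [s]) \<otimes>\<^bsub>coxeter_group S m\<^esub> generator S m s) (cls (x @ [s]))"
    unfolding bruhat_less_def bruhat_le_def eq using assms by blast
qed


section \<open>Alternating words are reduced\<close>

text \<open>The dual of the geometric representation, on functions \<open>f\<close> from \<open>S\<close> to the reals; it needs no
  sums over \<open>S\<close>.\<close>

definition cartan :: "'s \<Rightarrow> 's \<Rightarrow> real" where
  "cartan s t = (case m s t of enat k \<Rightarrow> - 2 * cos (pi / real k) | \<infinity> \<Rightarrow> - 2)"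

definition act :: "'s \<Rightarrow> ('s \<Rightarrow> real) \<Rightarrow> 's \<Rightarrow> real" where
  "act s f u = f u - cartan s u * f s"

lemma cartan_diag: "s \<in> S \<Longrightarrow> cartan s s = 2"
  using diag[of s] by (simp add: cartan_def one_enat_def)

text \<open>The coordinates at \<open>s\<close> and \<open>t\<close> evolve by themselves under
  powers of \<open>st\<close>, with the sines of a rotation by \<open>2 * \<theta>\<close> as
  coefficients. The factor \<open>sin \<theta>\<close> avoids a division.\<close>

lemma act_pair_power:
  fixes f :: "'s \<Rightarrow> real" and n :: nat and \<theta> :: real and F :: "nat \<Rightarrow> 's \<Rightarrow> real"
  assumes st: "s \<in> S" "t \<in> S" and m: "m s t = enat k"
  defines "\<theta> \<equiv> pi / real k"
  defines "F \<equiv> \<lambda>n. foldr act (alt_word (2 * n) s t) f"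
  shows "sin \<theta> * F n s = - sin ((2 * real n - 1) * \<theta>) * f s - sin (2 * real n * \<theta>) * f t"
    and "sin \<theta> * F n t = sin (2 * real n * \<theta>) * f s + sin ((2 * real n + 1) * \<theta>) * f t"
proof (induction n)
  case 0
  { case 1 show ?case by (simp add: F_def) }
  { case 2 show ?case by (simp add: F_def) }
next
  case (Suc n)
  define c where "c = 2 * cos \<theta>"
  have ca: "cartan s t = - c" "cartan t s = - c"
    using m symmetric[OF st] by (simp_all add: cartan_def c_def \<theta>_def)
  have rec: "F (Suc n) s = - F n s - c * F n t"
    "F (Suc n) t = - F n t - c * F (Suc n) s"
    using st ca by (simp_all add: F_def act_def cartan_diag algebra_simps)
  \<comment> \<open>The three-term recursion of the sine; the coordinates obey the same one, and its
    instances at \<open>2n\<close>, \<open>2n + 1\<close> and \<open>2n + 2\<close> drive the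
    induction.\<close>
  have S: "sin ((x + 1) * \<theta>) = c * sin (x * \<theta>) - sin ((x - 1) * \<theta>)" for x
    by (simp add: c_def algebra_simps sin_add sin_diff)
  have S1: "sin ((2 * real (Suc n) - 1) * \<theta>) = c * sin (2 * real n * \<theta>) - sin ((2 * real n - 1) * \<theta>)"
    using S[of "2 * n"] by (simp add: algebra_simps)
  have S2: "sin (2 * real (Suc n) * \<theta>) = c * sin ((2 * real n + 1) * \<theta>) - sin (2 * real n * \<theta>)"
    using S[of "2 * n + 1"] by (simp add: algebra_simps)
  have S3: "sin ((2 * real (Suc n) + 1) * \<theta>) = c * sin (2 * real (Suc n) * \<theta>) - sin ((2 * real n + 1) * \<theta>)"
    using S[of "2 * n + 2"] by (simp add: algebra_simps)
  have S4: "sin ((2 * real (Suc n) - 1) * \<theta>) = sin ((2 * real n + 1) * \<theta>)"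
    by (simp add: algebra_simps)
  have a: "sin \<theta> * F (Suc n) s = - (sin \<theta> * F n s) - c * (sin \<theta> * F n t)"
    by (simp add: rec(1) algebra_simps)
  have b: "sin \<theta> * F (Suc n) t = - (sin \<theta> * F n t) - c * (sin \<theta> * F (Suc n) s)"
    by (simp add: rec(2) algebra_simps)
  { case 1 show ?case
      unfolding a Suc S1 S2 by (simp add: algebra_simps) }
  note 1 = this
  { case 2 show ?case
      unfolding b Suc 1 S3 S4 unfolding S2 by (simp add: algebra_simps) }
qed


section \<open>Dihedral relations in the representation\<close>

lemma sin_dihedral_angle_pos:
  assumes "s \<in> S" "t \<in> S" "s \<noteq> t" "m s t = enat k"
  shows "sin (pi / real k) > 0" and "k \<ge> 2"
proof -
  show k: "k \<ge> 2" using off_diag[of s t] assms numeral_eq_enat[of "num.Bit0 num.One"]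
    by (metis enat_ord_simps(1))
  have "pi / real k < pi" using k by (simp add: field_simps)
  then show "sin (pi / real k) > 0" using k by (intro sin_gt_zero) auto
qed

text \<open>At \<open>n = k\<close> the angle \<open>2 * k * \<theta>\<close> is a full turn, so the
  coordinates at \<open>s\<close> and \<open>t\<close> return. Any other coordinate \<open>u\<close>
  returns because a suitable combination of the coordinates at \<open>u\<close>, \<open>s\<close>
  and \<open>t\<close> is fixed by both generators.\<close>

lemma act_relator:
  assumes st: "s \<in> S" "t \<in> S" and m: "m s t = enat k"
  shows "foldr act (alt_word (2 * k) s t) f = f"
proof (cases "s = t")
  case True
  then have "k = 1" using diag[of s] assms by (simp add: one_enat_def)
  then show ?thesis
    using st True by (auto simp: numeral_2_eq_2 act_def cartan_diag fun_eq_iff algebra_simps)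
next
  case False
  define \<theta> where "\<theta> = pi / real k"
  define c where "c = 2 * cos \<theta>"
  have pos: "sin \<theta> > 0" and k: "k \<ge> 2"
    using sin_dihedral_angle_pos[OF st False m] by (auto simp: \<theta>_def)
  have ca: "cartan s t = - c" "cartan t s = - c" "cartan s s = 2" "cartan t t = 2"
    using m st symmetric[OF st] cartan_diag by (simp_all add: cartan_def c_def \<theta>_def)
  \<comment> \<open>This is the determinant of the Cartan matrix of the pair, with diagonal
    \<open>2\<close> and off-diagonal \<open>- c\<close>.\<close>
  have c4: "4 - c\<^sup>2 > 0"
  proof -
    have "4 - c\<^sup>2 = 4 * (sin \<theta>)\<^sup>2" by (simp add: c_def power_mult_distrib sin_squared_eq)
    then show ?thesis using pos by simp
  qed
  let ?F = "foldr act (alt_word (2 * k) s t) f"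
  have th: "2 * real k * \<theta> = 2 * pi" using k by (simp add: \<theta>_def)
  have "(2 * real k - 1) * \<theta> = 2 * pi - \<theta>" "(2 * real k + 1) * \<theta> = \<theta> + 2 * pi"
    using th by (simp_all add: algebra_simps)
  then have trig: "sin ((2 * real k - 1) * \<theta>) = - sin \<theta>" "sin ((2 * real k + 1) * \<theta>) = sin \<theta>"
      "sin (2 * real k * \<theta>) = 0"
    unfolding th by (simp_all add: sin_diff)
  have "sin \<theta> * ?F s = sin \<theta> * f s" "sin \<theta> * ?F t = sin \<theta> * f t"
    using act_pair_power[OF st m, of k f, folded \<theta>_def] unfolding trig by simp_all
  then have fix_st: "?F s = f s" "?F t = f t" using pos by simp_all
  have "?F u = f u" for u
  proof -
    \<comment> \<open>Cramer's rule for \<open>2 * a - c * b = - cartan s u\<close> and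
      \<open>2 * b - c * a = - cartan t u\<close>, the conditions under which \<open>I\<close> below
      is invariant.\<close>
    define a where "a = (- 2 * cartan s u - c * cartan t u) / (4 - c\<^sup>2)"
    define b where "b = (- 2 * cartan t u - c * cartan s u) / (4 - c\<^sup>2)"
    have A: "a * (4 - c\<^sup>2) = - 2 * cartan s u - c * cartan t u"
      and B: "b * (4 - c\<^sup>2) = - 2 * cartan t u - c * cartan s u"
      using c4 by (simp_all add: a_def b_def)
    have "(2 * a - c * b) * (4 - c\<^sup>2) = 2 * (a * (4 - c\<^sup>2)) - c * (b * (4 - c\<^sup>2))"
      by (simp add: algebra_simps)
    also have "\<dots> = - cartan s u * (4 - c\<^sup>2)"
      unfolding A B by (simp add: algebra_simps power2_eq_square)
    finally have "2 * a - c * b = - cartan s u" using c4 by (metis less_irrefl mult_right_cancel)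
    then have ab1: "cartan s u = c * b - 2 * a" by simp
    have "(2 * b - c * a) * (4 - c\<^sup>2) = 2 * (b * (4 - c\<^sup>2)) - c * (a * (4 - c\<^sup>2))"
      by (simp add: algebra_simps)
    also have "\<dots> = - cartan t u * (4 - c\<^sup>2)"
      unfolding A B by (simp add: algebra_simps power2_eq_square)
    finally have "2 * b - c * a = - cartan t u" using c4 by (metis less_irrefl mult_right_cancel)
    then have ab2: "cartan t u = c * a - 2 * b" by simp
    define I where "I g = g u + a * g s + b * g t" for g :: "'s \<Rightarrow> real"
    have inv: "I (act s g) = I g" "I (act t g) = I g" for g
      by (simp_all add: I_def act_def ca ab1 ab2 algebra_simps)
    have I: "I (foldr act w f) = I f" if "set w \<subseteq> {s, t}" for w
      using that by (induction w) (auto simp: inv)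
    have "I ?F = I f" by (rule I[OF set_alt_word])
    then show ?thesis using fix_st by (simp add: I_def)
  qed
  then show ?thesis by blast
qed

text \<open>If the \<open>n\<close>-th power of \<open>st\<close> were trivial, it would act
  trivially, and the closed form would force \<open>cos (2 * n * \<theta>) = 1\<close> although
  \<open>n * \<theta>\<close> lies strictly between \<open>0\<close> and \<open>pi\<close>.\<close>

lemma word_class_dihedral_power:
  assumes st: "s \<in> S" "t \<in> S" "s \<noteq> t" and m: "m s t = enat k" and n: "0 < n" "n < k"
  shows "cls (alt_word (2 * n) s t) \<noteq> cls []"
proof
  assume eq: "cls (alt_word (2 * n) s t) = cls []"
  define \<theta> where "\<theta> = pi / real k"
  have pos: "sin \<theta> > 0" and k: "k \<ge> 2"
    using sin_dihedral_angle_pos[OF st m] by (auto simp: \<theta>_def)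
  have "foldr act (alt_word (2 * n) s t) = foldr act []"
  proof (rule word_class_invariant[OF eq])
    fix x y assume "word_step S m x y"
    then show "foldr act x = foldr act y"
      by cases (auto simp: concat_replicate_pair act_relator fun_eq_iff)
  qed (use st in auto)
  then have id: "foldr act (alt_word (2 * n) s t) f = f" for f by simp
  \<comment> \<open>With this vector the coordinate at \<open>s\<close> isolates
    \<open>sin (2 * n * \<theta>)\<close> and the coordinate at \<open>t\<close> isolates
    \<open>sin ((2 * n + 1) * \<theta>)\<close>.\<close>
  define f where "f u = (if u = t then 1 else 0 :: real)" for u
  have f: "f s = 0" "f t = 1" using st by (auto simp: f_def)
  have 1: "sin (2 * n * \<theta>) = 0" and 2: "sin ((2 * n + 1) * \<theta>) = sin \<theta>"
    using act_pair_power[OF st(1,2) m, of n f, folded \<theta>_def] unfolding id f by (simp_all add: add.commute)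
  have "sin ((2 * n + 1) * \<theta>) = sin (2 * n * \<theta>) * cos \<theta> + cos (2 * n * \<theta>) * sin \<theta>"
    by (simp add: algebra_simps sin_add)
  then have 3: "cos (2 * n * \<theta>) = 1" using 1 2 pos by simp
  have "n * \<theta> > 0" "n * \<theta> < pi" using n by (simp_all add: \<theta>_def field_simps)
  then have "sin (n * \<theta>) > 0" by (rule sin_gt_zero)
  moreover have "cos (2 * n * \<theta>) = 1 - 2 * (sin (n * \<theta>))\<^sup>2"
    using cos_double_sin[of "n * \<theta>"] by (simp add: mult.assoc)
  ultimately show False using 3 by simp
qed

text \<open>Deleting a relator deletes a list of reflections of the form \<open>A @ A\<close>, which
  changes every count by an even number, and leaves the other reflections unchanged as group
  elements.\<close>

lemma odd_count_refls_cong: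
  assumes "cls x = cls y" "x \<in> lists S" "y \<in> lists S"
  shows "odd (count_list (map cls (refls x)) r) = odd (count_list (map cls (refls y)) r)"
proof (rule word_class_invariant[OF assms])
  fix x y assume "word_step S m x y"
  then show "odd (count_list (map cls (refls x)) r) = odd (count_list (map cls (refls y)) r)"
  proof cases
    case (relator s t k x' y')
    let ?p = "alt_word (2 * k) s t"
    have p: "?p \<in> lists S" "cls ?p = cls []"
      using relator word_class_relator by auto
    define A where "A = map (\<lambda>i. cls (x' @ alt_word (2 * i + 1) s t @ rev x')) [0..<k]"
    \<comment> \<open>Moving on by \<open>k\<close> positions inserts one whole relator, so the
      second half of the list repeats the first.\<close>
    have "cls (x' @ alt_word (2 * (k + i) + 1) s t @ rev x') = cls (x' @ alt_word (2 * i + 1) s t @ rev x')" for i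
    proof -
      have "2 * (k + i) + 1 = 2 * k + (2 * i + 1)" by simp
      then have "alt_word (2 * (k + i) + 1) s t = ?p @ alt_word (2 * i + 1) s t"
        by (metis alt_word_add_even)
      moreover have "cls (?p @ alt_word (2 * i + 1) s t) = cls ([] @ alt_word (2 * i + 1) s t)"
        using p relator by (intro word_class_append_cong) auto
      ultimately show ?thesis
        using p relator by (intro word_class_append_cong) auto
    qed
    note shift = this
    have "map (\<lambda>i. cls (x' @ alt_word (2 * i + 1) s t @ rev x')) [k..<2 * k] = A"
      unfolding A_def using shift by (intro nth_equalityI) (auto simp: add.commute)
    moreover have "[0..<2 * k] = [0..<k] @ [k..<2 * k]"
      by (metis le_add_same_cancel1 mult_2 upt_add_eq_append zero_le)
    ultimately have mid: "map cls (map (\<lambda>r. x' @ r @ rev x') (refls ?p)) = A @ A"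
      by (simp add: refls_alt_word o_def A_def)
    \<comment> \<open>Behind the relator, reflections carry an additional conjugation by it, which
      is trivial in the group.\<close>
    have tl: "map cls (map (\<lambda>r. x' @ (?p @ r @ rev ?p) @ rev x') (refls y')) =
        map cls (map (\<lambda>r. x' @ r @ rev x') (refls y'))"
    proof -
      have rp: "cls (rev ?p) = cls []"
        using word_class_append_rev[OF p(1)] word_class_append_cong[OF p(2) refl p(1), of "rev ?p"] p
        by simp
      have "cls (x' @ (?p @ r @ rev ?p) @ rev x') = cls (x' @ ([] @ r @ []) @ rev x')"
        if "r \<in> lists S" for r
        using that relator p rp by (intro word_class_append_cong) auto
      then show ?thesis using refls_in_lists[of y'] relator by auto
    qed
    have "map cls (refls x) = map cls (refls x') @ (A @ A) @ map cls (map (\<lambda>r. x' @ r @ rev x') (refls y'))"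
      unfolding relator concat_replicate_pair refls_append map_append mid[symmetric] tl[symmetric]
      by (simp add: o_def)
    then show ?thesis unfolding relator(2) refls_append by auto
  qed
qed

text \<open>Distinct reflections occur once each, hence an odd number of times in every word for the
  same element; such a word has one reflection per letter and so cannot be shorter.\<close>

lemma reduced_word_if_distinct_refls:
  assumes "x \<in> lists S" "distinct (map cls (refls x))"
  shows "reduced_word S m x"
  unfolding reduced_word_def
proof (intro conjI ballI impI)
  fix y assume y: "y \<in> lists S" "cls y = cls x"
  have "set (map cls (refls x)) \<subseteq> set (map cls (refls y))"
  proof
    fix r assume "r \<in> set (map cls (refls x))"
    then have "count_list (map cls (refls x)) r = 1"
      using assms(2) by (metis distinct_count_list1)
    then have "odd (count_list (map cls (refls y)) r)"
      using odd_count_refls_cong[OF y(2) y(1) assms(1), of r] by simp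
    then show "r \<in> set (map cls (refls y))"
      by (metis count_notin even_zero)
  qed
  then have "card (set (map cls (refls x))) \<le> card (set (map cls (refls y)))"
    by (intro card_mono) auto
  also have "\<dots> \<le> length y" by (metis card_length length_map length_refls)
  finally show "length x \<le> length y" using distinct_card[OF assms(2)] by simp
qed (rule assms)

text \<open>If the reflections at positions \<open>i < j\<close> agreed, cancelling the common
  factor would make the power of \<open>st\<close> with exponent \<open>j - i < k\<close>
  trivial.\<close>

lemma reduced_alt_word:
  assumes st: "s \<in> S" "t \<in> S" "s \<noteq> t" and m: "m s t = enat k"
  shows "reduced_word S m (alt_word k s t)"
proof (rule reduced_word_if_distinct_refls)
  have neq: "cls (alt_word (2 * i + 1) s t) \<noteq> cls (alt_word (2 * j + 1) s t)" if "i < j" "j < k" for i j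
  proof
    assume eq: "cls (alt_word (2 * i + 1) s t) = cls (alt_word (2 * j + 1) s t)"
    let ?a = "alt_word (2 * i + 1) s t" and ?d = "alt_word (2 * (j - i)) s t"
    have "2 * j + 1 = 2 * (j - i) + (2 * i + 1)" using that by simp
    then have "alt_word (2 * j + 1) s t = ?d @ ?a" by (metis alt_word_add_even)
    then have "cls ((?d @ ?a) @ rev ?a) = cls (?a @ rev ?a)"
      using eq st by (intro word_class_append_cong) (simp_all del: alt_word.simps)
    moreover have a: "cls (?a @ rev ?a) = cls []" using st by (intro word_class_append_rev) simp
    moreover have "cls (?d @ (?a @ rev ?a)) = cls (?d @ [])"
      using st a by (intro word_class_append_cong) (simp_all del: alt_word.simps)
    ultimately have "cls ?d = cls []" by (simp del: alt_word.simps)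
    then show False using word_class_dihedral_power[OF st m, of "j - i"] that by auto
  qed
  have "inj_on (\<lambda>i. cls (alt_word (2 * i + 1) s t)) {0..<k}"
    by (rule linorder_inj_onI') (use neq in auto)
  then show "distinct (map cls (refls (alt_word k s t)))"
    by (simp add: refls_alt_word distinct_map o_def)
qed (use st in auto)

text \<open>By \<open>alt_word_append_rev\<close> the relator is one alternating word times the
  inverse of the other.\<close>

lemma word_class_braid:
  assumes st: "s \<in> S" "t \<in> S" and m: "m s t = enat k"
  shows "cls (alt_word k s t) = cls (alt_word k t s)"
proof -
  let ?a = "alt_word k s t" and ?b = "alt_word k t s"
  have "cls ((?a @ rev ?b) @ ?b) = cls ([] @ ?b)"
    using st word_class_relator[OF st m] unfolding alt_word_append_rev[of k s t]
    by (intro word_class_append_cong) auto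
  moreover have "cls (?a @ rev ?b @ rev (rev ?b)) = cls (?a @ [])"
    using word_class_append_rev[of "rev ?b"] st by (intro word_class_append_cong) simp_all
  ultimately show ?thesis by simp
qed

end


section \<open>Groupoids with a Weyl distance\<close>

context groupoid
begin

lemma inv_comp_cancel [simp]:
  assumes "g \<in> edges G" "h \<in> edges G"
  shows "tgt G g = src G h \<Longrightarrow> gcomp G (ginv G g) (gcomp G g h) = h"
    and "src G g = src G h \<Longrightarrow> gcomp G g (gcomp G (ginv G g) h) = h"
    and "tgt G h = src G g \<Longrightarrow> gcomp G (gcomp G h g) (ginv G g) = h"
proof -
  show "gcomp G (ginv G g) (gcomp G g h) = h" if "tgt G g = src G h"
    using that assms comp_assoc[of "ginv G g" g h] ident_comp[of h]
    by (simp add: inv_in init_inv term_inv inv_comp)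
  show "gcomp G g (gcomp G (ginv G g) h) = h" if "src G g = src G h"
    using that assms comp_assoc[of g "ginv G g" h] ident_comp[of h]
    by (simp add: inv_in init_inv term_inv comp_inv)
  show "gcomp G (gcomp G h g) (ginv G g) = h" if "tgt G h = src G g"
    using that assms comp_assoc[of h g "ginv G g"] comp_ident[of h]
    by (simp add: inv_in init_inv term_inv comp_inv)
qed

lemma inv_unique:
  assumes "g \<in> edges G" "h \<in> edges G" "tgt G g = src G h" "gcomp G g h = ident G (src G g)"
  shows "h = ginv G g"
  using inv_comp_cancel(1)[OF assms(1-3)] comp_ident[of "ginv G g"] assms
  by (simp add: inv_in term_inv)

lemma inv_inv [simp]: "g \<in> edges G \<Longrightarrow> ginv G (ginv G g) = g"
  using inv_unique[of "ginv G g" g] by (simp add: inv_in init_inv term_inv inv_comp)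

lemma inv_of_comp:
  assumes "g \<in> edges G" "h \<in> edges G" "tgt G g = src G h"
  shows "ginv G (gcomp G g h) = gcomp G (ginv G h) (ginv G g)"
proof (rule inv_unique[symmetric])
  have "gcomp G (gcomp G g h) (gcomp G (ginv G h) (ginv G g)) =
      gcomp G (gcomp G (gcomp G g h) (ginv G h)) (ginv G g)"
    using assms by (intro comp_assoc[symmetric])
      (simp_all add: comp_in term_comp inv_in init_inv term_inv)
  also have "\<dots> = ident G (src G g)" using assms by (simp add: comp_inv)
  finally show "gcomp G (gcomp G g h) (gcomp G (ginv G h) (ginv G g)) = ident G (src G (gcomp G g h))"
    using assms by (simp add: init_comp)
qed (use assms in \<open>simp_all add: comp_in term_comp init_comp inv_in init_inv term_inv\<close>)

end

context W_groupoid
begin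

text \<open>WG2 for \<open>g\<close> and its inverse puts this product below the identity, so its
  length is zero.\<close>

lemma delta_mult_delta_inv:
  assumes "g \<in> edges G"
  shows "\<delta> g \<otimes>\<^bsub>coxeter_group S m\<^esub> \<delta> (ginv G g) = \<one>\<^bsub>coxeter_group S m\<^esub>"
proof -
  interpret W: group "coxeter_group S m" by (rule group_coxeter_group)
  have "bruhat_le S m (\<delta> g \<otimes>\<^bsub>coxeter_group S m\<^esub> \<delta> (ginv G g)) (cls [])"
    using WG2[of g "ginv G g"] WG1[of "src G g"] assms
    by (simp add: inv_in init_inv comp_inv init_in one_eq_cls)
  then have "wlen (\<delta> g \<otimes>\<^bsub>coxeter_group S m\<^esub> \<delta> (ginv G g)) = 0"
    using bruhat_le_wlen(1) by fastforce
  then show ?thesis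
    using assms delta_in inv_in wlen_eq_0 one_eq_cls by simp
qed

lemma delta_inv_generator:
  assumes "g \<in> edges G" "s \<in> S" "\<delta> g = cls [s]"
  shows "\<delta> (ginv G g) = cls [s]"
proof -
  interpret W: group "coxeter_group S m" by (rule group_coxeter_group)
  show ?thesis
    using delta_mult_delta_inv[OF assms(1)] cls_generator_square[OF assms(2)] assms
    by (metis W.inv_equality W.inv_inv delta_in inv_in)
qed

lemma delta_inv_one:
  assumes "g \<in> edges G" "\<delta> g = cls []"
  shows "\<delta> (ginv G g) = cls []"
proof -
  interpret W: group "coxeter_group S m" by (rule group_coxeter_group)
  show ?thesis
    using delta_mult_delta_inv[OF assms(1)] assms W.l_one[OF delta_in[OF inv_in]]
    by (simp add: one_eq_cls)
qed

text \<open>WG2 for \<open>gh\<close> followed by the inverse of \<open>h\<close>. It bounds the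
  distance of \<open>gh\<close> from above, where WG2 for \<open>g\<close> and \<open>h\<close>
  bounds it from below.\<close>

lemma bruhat_delta_uncomp:
  assumes "g \<in> edges G" "h \<in> edges G" "tgt G g = src G h"
  shows "bruhat_le S m (\<delta> (gcomp G g h) \<otimes>\<^bsub>coxeter_group S m\<^esub> \<delta> (ginv G h)) (\<delta> g)"
  using WG2[of "gcomp G g h" "ginv G h"] assms
  by (simp add: comp_in inv_in term_comp init_inv)

lemma delta_comp_one:
  assumes "g \<in> edges G" "h \<in> edges G" "tgt G g = src G h" "\<delta> h = cls []"
  shows "\<delta> (gcomp G g h) = \<delta> g"
proof -
  interpret W: group "coxeter_group S m" by (rule group_coxeter_group)
  have "bruhat_le S m (\<delta> g) (\<delta> (gcomp G g h))" "bruhat_le S m (\<delta> (gcomp G g h)) (\<delta> g)"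
    using WG2[OF assms(1-3)] bruhat_delta_uncomp[OF assms(1-3)] delta_inv_one[OF assms(2,4)]
      delta_in[OF assms(1)] delta_in[OF comp_in[OF assms(1-3)]] assms(4)
    by (simp_all flip: one_eq_cls)
  then show ?thesis using bruhat_le_wlen by (metis order_antisym)
qed

lemma delta_comp_up:
  assumes gh: "g \<in> edges G" "h \<in> edges G" "tgt G g = src G h" and s: "s \<in> S" "\<delta> h = cls [s]"
    and up: "wlen (\<delta> g) < wlen (\<delta> g \<otimes>\<^bsub>coxeter_group S m\<^esub> cls [s])"
  shows "\<delta> (gcomp G g h) = \<delta> g \<otimes>\<^bsub>coxeter_group S m\<^esub> cls [s]"
proof -
  let ?v = "\<delta> (gcomp G g h)"
  have le: "bruhat_le S m (\<delta> g \<otimes>\<^bsub>coxeter_group S m\<^esub> cls [s]) ?v"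
    using WG2[OF gh] s by simp
  have "bruhat_le S m (?v \<otimes>\<^bsub>coxeter_group S m\<^esub> cls [s]) (\<delta> g)"
    using bruhat_delta_uncomp[OF gh] delta_inv_generator[OF gh(2) s] by simp
  then have "wlen (?v \<otimes>\<^bsub>coxeter_group S m\<^esub> cls [s]) \<le> wlen (\<delta> g)"
    by (rule bruhat_le_wlen)
  moreover have "wlen ?v \<le> wlen (?v \<otimes>\<^bsub>coxeter_group S m\<^esub> cls [s]) + 1"
    using delta_in[OF comp_in[OF gh]] s(1) by (rule wlen_mult_generator_le)
  \<comment> \<open>Writing \<open>v\<close> for \<open>?v\<close>, the chain \<open>wlen v \<le>
    wlen (vs) + 1 \<le> wlen (\<delta> g) + 1 \<le> wlen (\<delta> g s) \<le> wlen v\<close>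
    collapses.\<close>
  ultimately have "wlen (\<delta> g \<otimes>\<^bsub>coxeter_group S m\<^esub> cls [s]) = wlen ?v"
    using up bruhat_le_wlen(1)[OF le] by linarith
  then show ?thesis using bruhat_le_wlen(2)[OF le] by simp
qed

text \<open>Closure of the panel groupoids under composition.\<close>

lemma delta_comp_panel:
  assumes gh: "g \<in> edges G" "h \<in> edges G" "tgt G g = src G h" and s: "s \<in> S"
    and "\<delta> g \<in> {cls [], cls [s]}" "\<delta> h \<in> {cls [], cls [s]}"
  shows "\<delta> (gcomp G g h) \<in> {cls [], cls [s]}"
proof (cases "\<delta> h = cls []")
  case True
  then show ?thesis using delta_comp_one[OF gh] assms by simp
next
  case False
  then have h: "\<delta> h = cls [s]" using assms by simp
  interpret W: group "coxeter_group S m" by (rule group_coxeter_group)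
  let ?v = "\<delta> (gcomp G g h)"
  have v: "?v \<in> carrier (coxeter_group S m)" using gh delta_in comp_in by simp
  have sc: "cls [s] \<in> carrier (coxeter_group S m)" using s by (simp add: cls_in_carrier)
  show ?thesis
  proof (cases "\<delta> g = cls []")
    case True
    then have gs: "\<delta> g \<otimes>\<^bsub>coxeter_group S m\<^esub> cls [s] = cls [s]"
      using sc by (simp flip: one_eq_cls)
    show ?thesis
      using delta_comp_up[OF gh s h] True wlen_generator[OF s] unfolding gs by simp
  next
    case False
    then have g: "\<delta> g = cls [s]" using assms by simp
    \<comment> \<open>When both distances are \<open>s\<close>, \<open>delta_comp_up\<close> does
      not apply. The upper bound leaves only \<open>1\<close> and \<open>s\<close> for
      \<open>?v s\<close>, hence also for \<open>?v\<close>.\<close>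
    have le: "bruhat_le S m (?v \<otimes>\<^bsub>coxeter_group S m\<^esub> cls [s]) (cls [s])"
      using bruhat_delta_uncomp[OF gh] delta_inv_generator[OF gh(2) s h] g by simp
    have "?v \<otimes>\<^bsub>coxeter_group S m\<^esub> cls [s] \<in> {cls [], cls [s]}"
    proof (cases "wlen (?v \<otimes>\<^bsub>coxeter_group S m\<^esub> cls [s]) = 0")
      case True
      then show ?thesis using wlen_eq_0[OF W.m_closed[OF v sc]] by simp
    next
      case False
      then have "wlen (?v \<otimes>\<^bsub>coxeter_group S m\<^esub> cls [s]) = wlen (cls [s])"
        using bruhat_le_wlen(1)[OF le] wlen_generator[OF s] by linarith
      then show ?thesis using bruhat_le_wlen(2)[OF le] by simp
    qed
    then have "?v \<otimes>\<^bsub>coxeter_group S m\<^esub> cls [s] \<otimes>\<^bsub>coxeter_group S m\<^esub> cls [s] \<in> {cls [], cls [s]}"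
      using cls_generator_square[OF s] W.l_one[OF sc] by (auto simp: one_eq_cls)
    then show ?thesis using mult_generator_twice[OF v s] by simp
  qed
qed

end


section \<open>Galleries of the associated Weyl data\<close>

context strict_W_groupoid
begin

abbreviation \<W> :: "('s, 'v, 'e) weyl_data" where
  "\<W> \<equiv> associated_weyl_data S m G \<delta>"

lemma associated_simps [simp]:
  "chambers \<W> = vertices G"
  "vertices (panel_groupoid \<W> s) = vertices G"
  "edges (panel_groupoid \<W> s) = {g \<in> edges G. \<delta> g \<in> {cls [], cls [s]}}"
  "src (panel_groupoid \<W> s) = src G"
  "tgt (panel_groupoid \<W> s) = tgt G"
  "ident (panel_groupoid \<W> s) = ident G"
  "gcomp (panel_groupoid \<W> s) = gcomp G"
  "ginv (panel_groupoid \<W> s) = ginv G"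
  by (simp_all add: associated_weyl_data_def parabolic_groupoid_def one_eq_cls generator_def)

lemma edge_init_term [simp]: "edge_init \<W> i = src G (snd i)" "edge_term \<W> i = tgt G (snd i)"
  by (simp_all add: edge_init_def edge_term_def)

text \<open>By strictness, removing the identities from a panel groupoid removes exactly the edges
  of distance \<open>1\<close>.\<close>

lemma typed_edge_iff:
  "typed_edge S \<W> i \<longleftrightarrow> fst i \<in> S \<and> snd i \<in> edges G \<and> \<delta> (snd i) = cls [fst i]"
  using strict[of "snd i"] WG1 cls_one_neq_generator[of "fst i"]
  by (auto simp: typed_edge_def is_identity_def one_eq_cls)

lemma gal_term_simps [simp]:
  "gal_term \<W> (C, []) = C"
  "gal_term \<W> (C, i # js) = gal_term \<W> (tgt G (snd i), js)"
  by (simp_all add: gal_term_def)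

lemma edge_path_composite:
  assumes "edge_path S \<W> C js"
  shows "C \<in> vertices G" "path_comp G C (map snd js) \<in> edges G"
    "src G (path_comp G C (map snd js)) = C"
    "tgt G (path_comp G C (map snd js)) = gal_term \<W> (C, js)"
proof -
  have "C \<in> vertices G \<and> path_comp G C (map snd js) \<in> edges G \<and>
      src G (path_comp G C (map snd js)) = C \<and>
      tgt G (path_comp G C (map snd js)) = gal_term \<W> (C, js)"
    using assms
    by (induction js arbitrary: C)
      (auto simp: ident_in init_ident term_ident typed_edge_iff comp_in init_comp term_comp init_in)
  then show "C \<in> vertices G" "path_comp G C (map snd js) \<in> edges G"
    "src G (path_comp G C (map snd js)) = C"
    "tgt G (path_comp G C (map snd js)) = gal_term \<W> (C, js)" by auto
qed

lemma edge_path_append: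
  "edge_path S \<W> C (a @ b) \<longleftrightarrow> edge_path S \<W> C a \<and> edge_path S \<W> (gal_term \<W> (C, a)) b"
  by (induction a arbitrary: C) (auto dest: edge_path_composite(1))

lemma gal_term_append: "gal_term \<W> (C, a @ b) = gal_term \<W> (gal_term \<W> (C, a), b)"
  by (induction a arbitrary: C) auto

text \<open>Only the composite of \<open>b\<close> is constrained, so \<open>b\<close> may be a bare
  list of groupoid edges without types.\<close>

lemma path_comp_append:
  assumes "edge_path S \<W> C a" "path_comp G (gal_term \<W> (C, a)) b \<in> edges G"
    "src G (path_comp G (gal_term \<W> (C, a)) b) = gal_term \<W> (C, a)"
  shows "path_comp G C (map snd a @ b) =
    gcomp G (path_comp G C (map snd a)) (path_comp G (gal_term \<W> (C, a)) b)"
  using assms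
proof (induction a arbitrary: C)
  case Nil
  then show ?case using ident_comp[of "path_comp G C b"] by simp
next
  case (Cons i a)
  then show ?case
    using edge_path_composite[of "tgt G (snd i)" a] by (simp add: comp_assoc typed_edge_iff)
qed

text \<open>Each further letter of a reduced word raises the length, so \<open>delta_comp_up\<close>
  applies at every edge.\<close>

lemma delta_path_comp:
  assumes "edge_path S \<W> C js" "reduced_word S m (map fst js)"
  shows "\<delta> (path_comp G C (map snd js)) = cls (map fst js)"
  using assms
proof (induction js rule: rev_induct)
  case Nil
  then show ?case using WG1 by (simp add: one_eq_cls)
next
  case (snoc i js)
  let ?D = "gal_term \<W> (C, js)" and ?g = "path_comp G C (map snd js)"
  have p: "edge_path S \<W> C js" "typed_edge S \<W> i" "src G (snd i) = ?D"
    using snoc.prems(1) by (auto simp: edge_path_append)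
  then have i: "fst i \<in> S" "snd i \<in> edges G" "\<delta> (snd i) = cls [fst i]"
    by (auto simp: typed_edge_iff)
  have g: "?g \<in> edges G" "tgt G ?g = src G (snd i)"
    using edge_path_composite[OF p(1)] p(3) by auto
  have r: "reduced_word S m (map fst js)"
    using snoc.prems(2) reduced_word_butlast by simp
  then have l: "map fst js \<in> lists S" by (simp add: reduced_word_def)
  have IH: "\<delta> ?g = cls (map fst js)" using snoc.IH[OF p(1) r] .
  have gs: "\<delta> ?g \<otimes>\<^bsub>coxeter_group S m\<^esub> cls [fst i] = cls (map fst js @ [fst i])"
    unfolding IH using l i by (simp add: word_class_mult)
  have "path_comp G C (map snd (js @ [i])) = gcomp G ?g (snd i)"
    using path_comp_append[OF p(1), of "[snd i]"] i(2) p(3) by (simp add: comp_ident)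
  moreover have "wlen (\<delta> ?g) < wlen (\<delta> ?g \<otimes>\<^bsub>coxeter_group S m\<^esub> cls [fst i])"
    using snoc.prems(2) r by (simp add: gs) (simp add: IH reduced_word_iff_wlen)
  ultimately show ?case
    using delta_comp_up[OF g(1) i(2) g(2) i(1,3)] unfolding gs by simp
qed

text \<open>WG3 splits \<open>g\<close> into an edge \<open>h\<close> whose distance is given by the
  word without its last letter \<open>s\<close>, and the edge \<open>ginv G h\<close> followed by
  \<open>g\<close>, of distance \<open>s\<close>. At the empty word, strictness makes
  \<open>g\<close> an identity.\<close>

lemma path_comp_factor:
  assumes "g \<in> edges G" "reduced_word S m x" "\<delta> g = cls x"
  shows "\<exists>js. edge_path S \<W> (src G g) js \<and> map fst js = x \<and> path_comp G (src G g) (map snd js) = g"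
  using assms
proof (induction x arbitrary: g rule: rev_induct)
  case Nil
  then obtain C where "C \<in> vertices G" "g = ident G C"
    using strict[of g] by (auto simp: one_eq_cls is_identity_def)
  then show ?case by (intro exI[of _ "[]"]) (simp add: init_ident)
next
  case (snoc s x)
  have s: "s \<in> S" using snoc.prems(2) by (simp add: reduced_word_def)
  obtain h where h: "h \<in> edges G" "src G h = src G g"
    "\<delta> (gcomp G (ginv G h) g) = cls [s]" "\<delta> h = cls x"
    using WG3[OF snoc.prems(1) s] descent_bruhat_less[OF snoc.prems(2)] snoc.prems(3)
    by (auto simp: generator_def)
  obtain js where js: "edge_path S \<W> (src G g) js" "map fst js = x"
    "path_comp G (src G g) (map snd js) = h"
    using snoc.IH[OF h(1) reduced_word_butlast[OF snoc.prems(2)] h(4)] h(2) by auto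
  let ?k = "gcomp G (ginv G h) g"
  have k: "?k \<in> edges G" "src G ?k = tgt G h" "tgt G ?k = tgt G g"
    using h snoc.prems(1) by (simp_all add: comp_in init_comp term_comp inv_in init_inv term_inv)
  have t: "gal_term \<W> (src G g, js) = tgt G h"
    using edge_path_composite(4)[OF js(1)] js(3) by simp
  have "edge_path S \<W> (src G g) (js @ [(s, ?k)])"
    using js(1) k s h(3) snoc.prems(1) t by (simp add: edge_path_append typed_edge_iff term_in)
  moreover have "path_comp G (src G g) (map snd (js @ [(s, ?k)])) = g"
    using path_comp_append[OF js(1), of "[?k]"] js(3) k t comp_ident[OF k(1)] h(1,2) snoc.prems(1)
    by simp
  ultimately show ?case using js(2) by (intro exI[of _ "js @ [(s, ?k)]"]) simp
qed

section \<open>Defining suites and the homotopy invariance of composites\<close>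

lemma edge_path_associated_chamber_system:
  "edge_path S (associated_chamber_system S m G \<delta>) C js = edge_path S \<W> C js"
proof -
  have p: "panel_groupoid (associated_chamber_system S m G \<delta>) = panel_groupoid \<W>"
    "chambers (associated_chamber_system S m G \<delta>) = chambers \<W>"
    by (simp_all add: associated_chamber_system_def associated_weyl_data_def)
  then show ?thesis
    by (induction js arbitrary: C) (simp_all add: typed_edge_def edge_init_def edge_term_def)
qed

text \<open>The suites are defined over the chamber system without suites; here they are read as
  cycles of \<open>\<W>\<close> itself.\<close>

lemma mem_suites_iff:
  "\<beta> \<in> suites \<W> s t \<longleftrightarrow> finite_pair S m s t \<and> st_cycle S m \<W> s t \<beta> \<and>
    is_identity G (path_comp G (gal_init \<beta>) (map snd (snd \<beta>)))"
proof -
  have "gal_term (associated_chamber_system S m G \<delta>) \<beta> = gal_term \<W> \<beta>"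
    by (simp add: gal_term_def edge_term_def associated_chamber_system_def associated_weyl_data_def)
  then have "st_cycle S m (associated_chamber_system S m G \<delta>) s t \<beta> = st_cycle S m \<W> s t \<beta>"
    by (simp add: st_cycle_def gallery_def edge_path_associated_chamber_system)
  then show ?thesis by (simp add: associated_weyl_data_def)
qed

text \<open>The \<open>suite\<close> move does not compare the base chamber \<open>D'\<close> of the
  suite with the chamber \<open>D\<close> where it is deleted. The first edge of
  \<open>\<sigma>\<close> identifies them, and for empty \<open>\<sigma>\<close> the claims are
  trivial.\<close>

lemma suite_closed:
  assumes "edge_path S \<W> D \<sigma>" "(D', \<sigma>) \<in> suites \<W> s t"
  shows "gal_term \<W> (D, \<sigma>) = D" "path_comp G D (map snd \<sigma>) = ident G D"
proof -
  have D': "edge_path S \<W> D' \<sigma>" "gal_term \<W> (D', \<sigma>) = D'"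
    and i: "is_identity G (path_comp G D' (map snd \<sigma>))"
    using assms(2) by (simp_all add: mem_suites_iff st_cycle_def gallery_def gal_init_def)
  have "gal_term \<W> (D, \<sigma>) = D \<and> path_comp G D (map snd \<sigma>) = ident G D"
  proof (cases \<sigma>)
    case Nil
    then show ?thesis by simp
  next
    case (Cons j js)
    then have "D' = D" using assms(1) D'(1) by simp
    then show ?thesis
      using D' i edge_path_composite(3)[OF D'(1)] init_ident by (auto simp: is_identity_def)
  qed
  then show "gal_term \<W> (D, \<sigma>) = D" "path_comp G D (map snd \<sigma>) = ident G D" by auto
qed

text \<open>The three moves amount to an inverse law, associativity, and the fact that a suite
  composes to an identity.\<close>

lemma elementary_homotopy_composite:
  assumes "elementary_homotopy S m \<W> \<beta> \<gamma>"
  shows "path_comp G (fst \<beta>) (map snd (snd \<beta>)) = path_comp G (fst \<gamma>) (map snd (snd \<gamma>))"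
proof -
  \<comment> \<open>Reduces each move to comparing the composites of what follows the common prefix
    \<open>\<alpha>\<close>.\<close>
  have *: "path_comp G C (map snd \<alpha> @ x) = path_comp G C (map snd \<alpha> @ y)"
    if "edge_path S \<W> C \<alpha>" "path_comp G (gal_term \<W> (C, \<alpha>)) x = path_comp G (gal_term \<W> (C, \<alpha>)) y"
      "path_comp G (gal_term \<W> (C, \<alpha>)) x \<in> edges G"
      "src G (path_comp G (gal_term \<W> (C, \<alpha>)) x) = gal_term \<W> (C, \<alpha>)" for C \<alpha> x y
    using that path_comp_append[of C \<alpha> x] path_comp_append[of C \<alpha> y] by simp
  show ?thesis
    using assms
  proof cases
    case (cancel C \<alpha> s i \<beta>')
    let ?D = "gal_term \<W> (C, \<alpha>)"
    have p: "edge_path S \<W> C \<alpha>" "i \<in> edges G" "src G i = ?D" "edge_path S \<W> (tgt G i) ((s, ginv G i) # \<beta>')"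
      using cancel(3) by (auto simp: gallery_def edge_path_append typed_edge_iff)
    have q: "edge_path S \<W> ?D \<beta>'" using p by (simp add: term_inv)
    note c = edge_path_composite[OF q]
    have "path_comp G ?D (map snd \<beta>') =
        path_comp G ?D (map snd ([(s, i), (s, ginv G i)] @ \<beta>'))"
      using c p by (simp add: term_inv)
    from *[OF p(1) this c(2,3)] show ?thesis unfolding cancel by simp
  next
    case (compose C \<alpha> s i i' \<beta>')
    let ?D = "gal_term \<W> (C, \<alpha>)"
    have p: "edge_path S \<W> C \<alpha>" "i \<in> edges G" "i' \<in> edges G" "src G i = ?D" "tgt G i = src G i'"
        "edge_path S \<W> ?D ([(s, i), (s, i')] @ \<beta>')" "edge_path S \<W> (tgt G i') \<beta>'"
      using compose(3) by (auto simp: gallery_def edge_path_append typed_edge_iff)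
    have "path_comp G ?D (map snd ([(s, i), (s, i')] @ \<beta>')) =
        path_comp G ?D (map snd ([(s, gcomp G i i')] @ \<beta>'))"
      using p edge_path_composite[OF p(7)] by (simp add: comp_assoc term_comp)
    then show ?thesis
      unfolding compose using *[OF p(1), of "map snd ([(s, i), (s, i')] @ \<beta>')"]
        edge_path_composite[OF p(6)] by simp
  next
    case (suite C \<alpha> \<sigma> \<beta>' s t D')
    let ?D = "gal_term \<W> (C, \<alpha>)"
    have p: "edge_path S \<W> C \<alpha>" "edge_path S \<W> ?D \<sigma>" "edge_path S \<W> ?D (\<sigma> @ \<beta>')"
      using suite(3) by (auto simp: gallery_def edge_path_append)
    note cl = suite_closed[OF p(2) suite(5)]
    have q: "edge_path S \<W> ?D \<beta>'" using p(3) cl(1) by (simp add: edge_path_append)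
    note c = edge_path_composite[OF q]
    have "path_comp G ?D (map snd (\<sigma> @ \<beta>')) = path_comp G ?D (map snd \<beta>')"
      using path_comp_append[OF p(2), of "map snd \<beta>'"] c cl ident_comp[OF c(2)] by simp
    then show ?thesis
      unfolding suite using *[OF p(1), of "map snd (\<sigma> @ \<beta>')"] edge_path_composite[OF p(3)] by simp
  qed
qed

lemma homotopic_composite:
  assumes "homotopic S m \<W> \<beta> \<gamma>"
  shows "path_comp G (fst \<beta>) (map snd (snd \<beta>)) = path_comp G (fst \<gamma>) (map snd (snd \<gamma>))"
  using assms unfolding homotopic_def
  by (induction rule: equivclp_induct) (auto dest: elementary_homotopy_composite)

section \<open>Inverse galleries and axiom PW1\<close>

fun inverse_path :: "('s \<times> 'e) list \<Rightarrow> ('s \<times> 'e) list" where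
  "inverse_path [] = []"
| "inverse_path ((s, i) # js) = inverse_path js @ [(s, ginv G i)]"

lemma map_fst_inverse_path: "map fst (inverse_path js) = rev (map fst js)"
  by (induction js rule: inverse_path.induct) auto

text \<open>Generators are involutions, so inverse edges keep their type and the reversed list is
  again a gallery.\<close>

lemma inverse_path_composite:
  assumes "edge_path S \<W> C js"
  shows "edge_path S \<W> (gal_term \<W> (C, js)) (inverse_path js)"
    "gal_term \<W> (gal_term \<W> (C, js), inverse_path js) = C"
    "path_comp G (gal_term \<W> (C, js)) (map snd (inverse_path js)) =
      ginv G (path_comp G C (map snd js))"
proof -
  have "edge_path S \<W> (gal_term \<W> (C, js)) (inverse_path js) \<and>
    gal_term \<W> (gal_term \<W> (C, js), inverse_path js) = C \<and>
    path_comp G (gal_term \<W> (C, js)) (map snd (inverse_path js)) =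
      ginv G (path_comp G C (map snd js))"
    using assms
  proof (induction js arbitrary: C rule: inverse_path.induct)
    case 1
    then show ?case
      using inv_unique[of "ident G C" "ident G C"] ident_comp[of "ident G C"]
      by (simp add: ident_in init_ident term_ident)
  next
    case (2 s i js)
    let ?D = "gal_term \<W> (tgt G i, js)"
    have p: "s \<in> S" "i \<in> edges G" "\<delta> i = cls [s]" "src G i = C" "edge_path S \<W> (tgt G i) js"
      using 2(2) by (auto simp: typed_edge_iff)
    note IH = 2(1)[OF p(5)] and c = edge_path_composite[OF p(5)]
    have q: "edge_path S \<W> ?D (inverse_path js)" using IH by blast
    show ?case
      using IH c p edge_path_composite(1)[OF 2(2)] path_comp_append[OF q, of "[ginv G i]"] comp_ident[OF inv_in[OF p(2)]]
      by (simp add: edge_path_append gal_term_append typed_edge_iff delta_inv_generator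
          inv_in init_inv term_inv init_in inv_of_comp)
  qed
  then show "edge_path S \<W> (gal_term \<W> (C, js)) (inverse_path js)"
    "gal_term \<W> (gal_term \<W> (C, js), inverse_path js) = C"
    "path_comp G (gal_term \<W> (C, js)) (map snd (inverse_path js)) =
      ginv G (path_comp G C (map snd js))" by auto
qed

text \<open>Cancellation starts at the innermost pair, the inverse of the first edge of
  \<open>js\<close> followed by that edge.\<close>

lemma homotopic_cancel_inverse_path:
  assumes "edge_path S \<W> C (\<alpha> @ inverse_path js @ js)"
  shows "homotopic S m \<W> (C, \<alpha> @ inverse_path js @ js) (C, \<alpha>)"
  using assms
proof (induction js rule: inverse_path.induct)
  case 1
  then show ?case by (simp add: homotopic_def)
next
  case (2 s i js)
  let ?a = "\<alpha> @ inverse_path js"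
  have i: "i \<in> edges G" using 2(2) by (auto simp: edge_path_append typed_edge_iff)
  have "elementary_homotopy S m \<W>
      (C, ?a @ [(s, ginv G i), (s, ginv (panel_groupoid \<W> s) (ginv G i))] @ js) (C, ?a @ js)"
    by (rule elementary_homotopy.cancel) (use 2(2) i in \<open>simp add: gallery_def\<close>)
  then have "elementary_homotopy S m \<W> (C, \<alpha> @ inverse_path ((s, i) # js) @ (s, i) # js) (C, ?a @ js)"
    using i by simp
  moreover have "edge_path S \<W> C (?a @ js)"
    using 2(2) i by (auto simp: edge_path_append gal_term_append init_inv term_inv)
  then have "homotopic S m \<W> (C, ?a @ js) (C, \<alpha>)" using 2(1) by simp
  ultimately show ?case
    unfolding homotopic_def by (meson equivclp_trans r_into_equivclp)
qed

lemma maximal_geodesic_homotopic: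
  assumes f: "finite_pair S m s t" and b: "maximal_geodesic S m \<W> s t \<beta>"
  shows "\<exists>\<gamma>. maximal_geodesic S m \<W> t s \<gamma> \<and> homotopic S m \<W> \<beta> \<gamma>"
proof -
  have st: "s \<in> S" "t \<in> S" "s \<noteq> t" using f by (auto simp: finite_pair_def)
  obtain k where k: "m s t = enat k" "m t s = enat k"
    using f symmetric[OF st(1,2)] by (auto simp: finite_pair_def)
  obtain C js where \<beta>: "\<beta> = (C, js)" by force
  have js: "edge_path S \<W> C js" "map fst js = alt_word k s t"
    using b k by (auto simp: \<beta> maximal_geodesic_def gallery_def gal_type_def)
  define g where "g = path_comp G C (map snd js)"
  have g: "g \<in> edges G" "src G g = C" "tgt G g = gal_term \<W> (C, js)"
    using edge_path_composite[OF js(1)] by (simp_all add: g_def)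
  \<comment> \<open>Both alternating words represent the distance of \<open>g\<close>, so
    \<open>g\<close> also factors along the word that begins with \<open>t\<close>.\<close>
  have "\<delta> g = cls (alt_word k t s)"
    using delta_path_comp[OF js(1)] reduced_alt_word[OF st k(1)] word_class_braid[OF st(1,2) k(1)]
    by (simp add: g_def js(2))
  then obtain ks where ks: "edge_path S \<W> C ks" "map fst ks = alt_word k t s"
      "path_comp G C (map snd ks) = g"
    using path_comp_factor[OF g(1) reduced_alt_word[OF st(2,1) _ k(2)]] st(3) g(2) by auto
  have tk: "gal_term \<W> (C, ks) = gal_term \<W> (C, js)"
    using edge_path_composite(4)[OF ks(1)] ks(3) g(3) by simp
  note inv = inverse_path_composite[OF ks(1), unfolded tk ks(3)]
  have cyc: "edge_path S \<W> C (js @ inverse_path ks)" "gal_term \<W> (C, js @ inverse_path ks) = C"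
    using js(1) inv by (simp_all add: edge_path_append gal_term_append)
  have "path_comp G C (map snd (js @ inverse_path ks)) = ident G C"
    using path_comp_append[OF js(1), of "map snd (inverse_path ks)"] inv(3) g
    by (simp add: inv_in init_inv comp_inv flip: g_def)
  \<comment> \<open>\<open>js\<close> and \<open>ks\<close> have the same composite, so this cycle
    composes to an identity; its type is alternating of length \<open>2 * k\<close>.\<close>
  then have "(C, js @ inverse_path ks) \<in> suites \<W> s t"
    using f cyc js(2) ks(2) k edge_path_composite(1)[OF js(1)]
    by (auto simp: mem_suites_iff st_cycle_def gallery_def gal_init_def gal_type_def
        is_identity_def map_fst_inverse_path alt_word_append_rev)
  \<comment> \<open>One gallery reduced in two ways: deleting the suite leaves \<open>ks\<close>,
    cancelling \<open>inverse_path ks @ ks\<close> leaves \<open>js\<close>.\<close>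
  moreover have path: "edge_path S \<W> C (js @ inverse_path ks @ ks)"
    using cyc ks(1) edge_path_append[of C "js @ inverse_path ks" ks] by simp
  ultimately have "elementary_homotopy S m \<W> (C, [] @ (js @ inverse_path ks) @ ks) (C, [] @ ks)"
    using f by (intro elementary_homotopy.suite) (simp_all add: gallery_def)
  then have "homotopic S m \<W> (C, js @ inverse_path ks @ ks) (C, ks)"
    unfolding homotopic_def by (simp add: r_into_equivclp)
  moreover have "homotopic S m \<W> (C, js @ inverse_path ks @ ks) \<beta>"
    unfolding \<beta> by (rule homotopic_cancel_inverse_path[OF path])
  ultimately have "homotopic S m \<W> \<beta> (C, ks)"
    unfolding homotopic_def by (meson equivclp_sym equivclp_trans)
  moreover have "maximal_geodesic S m \<W> t s (C, ks)"
    using ks k by (simp add: maximal_geodesic_def gallery_def gal_type_def)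
  ultimately show ?thesis by blast
qed

section \<open>Panels and the Weyl graph axioms\<close>

lemma groupoid_panel:
  assumes s: "s \<in> S"
  shows "groupoid (panel_groupoid \<W> s)"
proof -
  have i: "\<delta> (ginv G g) \<in> {cls [], cls [s]}" if "g \<in> edges G" "\<delta> g \<in> {cls [], cls [s]}" for g
    using that delta_inv_one[of g] delta_inv_generator[OF _ s, of g] by auto
  show ?thesis
  proof (unfold_locales, goal_cases)
    \<comment> \<open>Cases 7 and 13 are closure under composition and inversion; identities belong
      to the panel groupoid by WG1, and the other laws are inherited from \<open>G\<close>.\<close>
    case (7 g h)
    then show ?case using delta_comp_panel[of g h s] s comp_in by simp
  next
    case (13 g)
    then show ?case using i[of g] inv_in by simp
  qed (use nonempty WG1 in \<open>auto simp: init_in term_in ident_in init_ident term_ident init_comp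
      term_comp comp_assoc ident_comp comp_ident init_inv term_inv comp_inv inv_comp one_eq_cls\<close>)
qed

text \<open>The edge of distance \<open>s\<close> that \<open>weak\<close> provides at
  \<open>C\<close> lies in the same component as the identity at \<open>C\<close> and differs from
  it.\<close>

lemma panel_nontrivial:
  assumes s: "s \<in> S" and C: "C \<in> vertices G"
  shows "\<not> trivial_groupoid (component (panel_groupoid \<W> s) C)"
proof
  assume "trivial_groupoid (component (panel_groupoid \<W> s) C)"
  then obtain e where e: "edges (component (panel_groupoid \<W> s) C) = {e}"
    by (auto simp: trivial_groupoid_def)
  obtain g where g: "g \<in> edges G" "src G g = C" "\<delta> g = cls [s]"
    using weak[OF C s] by (auto simp: generator_def)
  have I: "ident G C \<in> edges G" "src G (ident G C) = C" "tgt G (ident G C) = C" "\<delta> (ident G C) = cls []"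
    using C WG1[OF C] by (simp_all add: ident_in init_ident term_ident one_eq_cls)
  have "ident G C \<in> edges (component (panel_groupoid \<W> s) C)"
    using I by (auto simp: component_def Let_def)
  moreover have "g \<in> edges (component (panel_groupoid \<W> s) C)"
    using I g by (auto simp: component_def Let_def)
  ultimately have "g = ident G C" using e by simp
  then show False using g(3) I(4) cls_one_neq_generator[OF s] by simp
qed

lemma weyl_graph_associated: "weyl_graph S m \<W>"
proof -
  have "is_weyl_data S m \<W>"
    using groupoid_panel by (simp add: is_weyl_data_def generalized_chamber_system_def mem_suites_iff)
  then have "pre_weyl_graph S m \<W>"
    unfolding pre_weyl_graph_def using panel_nontrivial maximal_geodesic_homotopic by simp
  moreover have "W_length S m \<beta> = W_length S m \<gamma>"
    if "geodesic S m \<W> \<beta>" "geodesic S m \<W> \<gamma>" "homotopic S m \<W> \<beta> \<gamma>" for \<beta> \<gamma>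
  proof -
    have "\<delta> (path_comp G (fst \<beta>) (map snd (snd \<beta>))) = W_length S m \<beta>"
      "\<delta> (path_comp G (fst \<gamma>) (map snd (snd \<gamma>))) = W_length S m \<gamma>"
      using that delta_path_comp by (auto simp: geodesic_def gallery_def W_length_def gal_type_def)
    then show ?thesis using homotopic_composite[OF that(3)] by simp
  qed
  ultimately show ?thesis unfolding weyl_graph_def by blast
qed

end

theorem lemma5p18:
  fixes S :: "'s set" and m :: "'s \<Rightarrow> 's \<Rightarrow> enat"
    and G :: "('v, 'e) groupoid" and \<delta> :: "'e \<Rightarrow> 's list set"
  assumes "strict_W_groupoid S m G \<delta>"
  shows "weyl_graph S m (associated_weyl_data S m G \<delta>)"
  using assms by (rule strict_W_groupoid.weyl_graph_associated)

end
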